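(* Let $(\Gamma,\mu)$ be a weighted graph satisfying $(p_0)$, $(\overline{E})$ and the elliptic Harnack inequality $(H)$. Then there are constants $Q,c,C,D>0$ such that, with $l_9$ defined using this $Q$, for all $x,y\in\Gamma$ with $x\ne y$ and all integers $n\ge d(x,y)$, $$\widetilde{p}_n(x,y)\ge\frac{c}{V(x,e(x,n))\,r^{D}}\exp\left(-C\,l\right),$$ where $d=d(x,y)$, $l=l_9\left(x,y,\tfrac n2,d\right)$ and $r=\frac{d}{3l}$.
   Context: $\Gamma$ is an infinite connected graph without loops or multiple edges; $x\sim y$ denotes adjacency. A symmetric weight $\mu_{x,y}=\mu_{y,x}>0$ is given on the edges; $\mu(x)=\sum_{y\sim x}\mu_{x,y}$ (finite), $\mu(A)=\sum_{y\in A}\mu(y)$. $(X_n)$ is the random walk on $\Gamma$ with transition probabilities $P(x,y)=\mu_{x,y}/\mu(x)$ for $x\sim y$ and $0$ otherwise; $\mathbb{P}_x,\mathbb{E}_x$ are probability and expectation for $X_0=x$. The heat kernel is $p_n(x,y)=\mathbb{P}_x(X_n=y)/\mu(y)$, and $\widetilde{p}_n(x,y)=p_n(x,y)+p_{n+1}(x,y)$. Condition $(p_0)$: there is $p_0>0$ with $P(x,y)\ge p_0$ for all $x\sim y$. $d$ is the shortest-path graph distance, $B(x,R)=\{y:d(x,y)<R\}$, $V(x,R)=\mu(B(x,R))$. For $A\subset\Gamma$, $\partial A$ is the set of vertices outside $A$ adjacent to a vertex of $A$; $T_A=\inf\{t\ge0:X_t\in\Gamma\setminus A\}$ is the exit time.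 Write $E_y(x,R)=\mathbb{E}_y(T_{B(x,R)})$, $E(x,R)=E_x(x,R)$, $\overline{E}(x,R)=\max_{y\in B(x,R)}E_y(x,R)$. Condition $(\overline{E})$: there is $C>0$ with $\overline{E}(x,R)\le C\,E(x,R)$ for all $x\in\Gamma$, $R>0$. Elliptic Harnack inequality $(H)$: there is $C>0$ such that for all $x\in\Gamma$, $R>0$ and every non-negative function $u$ defined on $B(x,2R)\cup\partial B(x,2R)$ and harmonic on $B(x,2R)$ (i.e. $\sum_{z}P(y,z)u(z)=u(y)$ for all $y\in B(x,2R)$), $\max_{B(x,R)}u\le C\min_{B(x,R)}u$. $e(x,n)=\min\{r\in\{1,2,\dots\}:E(x,r)\ge n\}$ (the inverse of $E(x,\cdot)$). $\pi_{x,y}$ is the set of all vertices lying on some shortest path from $x$ to $y$. For a constant $Q>0$ and real $s,R> 0$: $l_9(x,y,s,R)$ is the minimal integer $l\ge1$ for which $\frac{s}{l}\ge Q\max_{z\in\pi_{x,y}}E(z,\frac{9R}{l})$, and $l_9(x,y,s,R)=R$ if there is no such integer. *)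

theory Defs
  imports "HOL-Probability.Probability"
begin

text \<open>
  The vertex set is the whole type; \<open>w\<close> is the weight function, whose values off the edges
  are never used.
\<close>

locale weighted_graph =
  fixes adj :: "'a \<Rightarrow> 'a \<Rightarrow> bool" (infix \<open>\<sim>\<close> 50)
    and w :: "'a \<Rightarrow> 'a \<Rightarrow> real"
  assumes adj_sym: "x \<sim> y \<Longrightarrow> y \<sim> x"
    and adj_irrefl: "\<not> x \<sim> x"
    and infinite_vertices: "infinite (UNIV :: 'a set)"
    and connected: "\<exists>xs. xs \<noteq> [] \<and> hd xs = x \<and> last xs = y \<and> successively adj xs"
    and w_sym: "x \<sim> y \<Longrightarrow> w x y = w y x"
    and w_pos: "x \<sim> y \<Longrightarrow> w x y > 0"
    and w_summable: "w x summable_on {y. x \<sim> y}"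
begin

subsection \<open>Paths, distance, balls\<close>

definition walk_betw :: "'a \<Rightarrow> 'a list \<Rightarrow> 'a \<Rightarrow> bool" where
  "walk_betw x xs y \<longleftrightarrow> xs \<noteq> [] \<and> hd xs = x \<and> last xs = y \<and> successively adj xs"

definition gdist :: "'a \<Rightarrow> 'a \<Rightarrow> nat" where
  "gdist x y = (LEAST n. \<exists>xs. walk_betw x xs y \<and> length xs = Suc n)"

text \<open>The set \<open>\<pi>\<^sub>x\<^sub>,\<^sub>y\<close> of vertices on shortest paths.\<close>

definition geod :: "'a \<Rightarrow> 'a \<Rightarrow> 'a set" where
  "geod x y = {z. \<exists>xs. walk_betw x xs y \<and> length xs = Suc (gdist x y) \<and> z \<in> set xs}"

definition gball :: "'a \<Rightarrow> real \<Rightarrow> 'a set" where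
  "gball x R = {y. real (gdist x y) < R}"

definition gboundary :: "'a set \<Rightarrow> 'a set" where
  "gboundary A = {z. z \<notin> A \<and> (\<exists>y\<in>A. y \<sim> z)}"

subsection \<open>Measure and random walk\<close>

definition vmeas :: "'a \<Rightarrow> real" where
  "vmeas x = (\<Sum>\<^sub>\<infinity>y\<in>{y. x \<sim> y}. w x y)"

definition vol :: "'a \<Rightarrow> real \<Rightarrow> real" where
  "vol x R = (\<Sum>\<^sub>\<infinity>y\<in>gball x R. vmeas y)"

definition trans_prob :: "'a \<Rightarrow> 'a \<Rightarrow> real" where
  "trans_prob x y = (if x \<sim> y then w x y / vmeas x else 0)"

definition walk_kernel :: "'a \<Rightarrow> nat \<Rightarrow> (nat \<Rightarrow> 'a) \<Rightarrow> 'a measure" where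
  "walk_kernel x n \<omega> =
     (case n of 0 \<Rightarrow> measure_pmf (return_pmf x)
      | Suc m \<Rightarrow> measure_pmf (embed_pmf (trans_prob (\<omega> m))))"

text \<open>
  Law of the walk started at \<open>x\<close>, on the trajectory space \<open>nat \<Rightarrow> 'a\<close>, given by the
  Ionescu-Tulcea theorem; \<open>X\<^sub>n\<close> is the \<open>n\<close>-th coordinate. The lemmas \<open>path_law_0\<close> and
  \<open>path_law_Suc\<close> below express the start at \<open>x\<close> and the Markov property.
\<close>

definition path_law :: "'a \<Rightarrow> (nat \<Rightarrow> 'a) measure" where
  "path_law x = projective_family.lim UNIV
     (Ionescu_Tulcea.CI (walk_kernel x) (\<lambda>_. count_space UNIV)) (\<lambda>_. count_space UNIV)"

definition heat_kernel :: "nat \<Rightarrow> 'a \<Rightarrow> 'a \<Rightarrow> real" where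
  "heat_kernel n x y = measure (path_law x) {\<omega> \<in> space (path_law x). \<omega> n = y} / vmeas y"

definition heat_kernel2 :: "nat \<Rightarrow> 'a \<Rightarrow> 'a \<Rightarrow> real" where
  "heat_kernel2 n x y = heat_kernel n x y + heat_kernel (Suc n) x y"

subsection \<open>Exit times\<close>

text \<open>The infimum of the empty set is \<open>\<infinity>\<close>; expectations are taken in \<open>[0,\<infinity>]\<close>.\<close>

definition exit_time :: "'a set \<Rightarrow> (nat \<Rightarrow> 'a) \<Rightarrow> enat" where
  "exit_time A \<omega> = (INF t\<in>{t. \<omega> t \<notin> A}. enat t)"

definition mean_exit_from :: "'a \<Rightarrow> 'a \<Rightarrow> real \<Rightarrow> ennreal" where
  "mean_exit_from y x R = (\<integral>\<^sup>+\<omega>. ennreal_of_enat (exit_time (gball x R) \<omega>) \<partial>path_law y)"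

definition mean_exit :: "'a \<Rightarrow> real \<Rightarrow> ennreal" where
  "mean_exit x R = mean_exit_from x x R"

text \<open>
  The maxima below range over balls and over sets \<open>geod x y\<close>. Under condition \<open>cond_p0\<close>
  these are finite; see \<open>finite_gball\<close> and \<open>finite_geod\<close>.
\<close>

definition max_mean_exit :: "'a \<Rightarrow> real \<Rightarrow> ennreal" where
  "max_mean_exit x R = Max ((\<lambda>y. mean_exit_from y x R) ` gball x R)"

definition inv_mean_exit :: "'a \<Rightarrow> nat \<Rightarrow> nat" where
  "inv_mean_exit x n = (LEAST r. r \<ge> 1 \<and> mean_exit x (real r) \<ge> of_nat n)"

subsection \<open>Conditions\<close>

definition cond_p0 :: bool where
  "cond_p0 \<longleftrightarrow> (\<exists>p0>0. \<forall>x y. x \<sim> y \<longrightarrow> trans_prob x y \<ge> p0)"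

definition cond_E_bar :: bool where
  "cond_E_bar \<longleftrightarrow>
     (\<exists>C>0. \<forall>x. \<forall>R>0. max_mean_exit x R \<le> ennreal C * mean_exit x R)"

text \<open>
  A function defined on \<open>A \<union> gboundary A\<close> is represented by a total function; its values
  outside this set do not matter, since \<open>trans_prob y z = 0\<close> for \<open>y \<in> A\<close> and \<open>z\<close> outside.
\<close>

definition harmonic_on :: "('a \<Rightarrow> real) \<Rightarrow> 'a set \<Rightarrow> bool" where
  "harmonic_on u A \<longleftrightarrow> (\<forall>y\<in>A. ((\<lambda>z. trans_prob y z * u z) has_sum u y) UNIV)"

definition elliptic_harnack :: bool where
  "elliptic_harnack \<longleftrightarrow>
     (\<exists>C>0. \<forall>x. \<forall>R>0. \<forall>u.
        (\<forall>z \<in> gball x (2 * R) \<union> gboundary (gball x (2 * R)). u z \<ge> 0) \<longrightarrow>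
        harmonic_on u (gball x (2 * R)) \<longrightarrow>
        Max (u ` gball x R) \<le> C * Min (u ` gball x R))"

subsection \<open>The chaining number\<close>

definition l9_admissible :: "real \<Rightarrow> 'a \<Rightarrow> 'a \<Rightarrow> real \<Rightarrow> real \<Rightarrow> nat \<Rightarrow> bool" where
  "l9_admissible Q x y s R l \<longleftrightarrow> l \<ge> 1 \<and>
     ennreal (s / real l) \<ge> ennreal Q * Max ((\<lambda>z. mean_exit z (9 * R / real l)) ` geod x y)"

definition l9 :: "real \<Rightarrow> 'a \<Rightarrow> 'a \<Rightarrow> real \<Rightarrow> real \<Rightarrow> real" where
  "l9 Q x y s R = (if \<exists>l. l9_admissible Q x y s R l
     then real (LEAST l. l9_admissible Q x y s R l) else R)"

subsection \<open>Well-definedness\<close>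

lemma ex_adj: "\<exists>y. x \<sim> y"
proof -
  have "UNIV \<noteq> {x}"
    using infinite_vertices by (metis finite.emptyI finite_insert)
  then obtain y where "y \<noteq> x" by blast
  obtain xs where xs: "xs \<noteq> []" "hd xs = x" "last xs = y" "successively adj xs"
    using connected by blast
  then obtain ys where ys: "xs = x # ys" by (cases xs) auto
  have "ys \<noteq> []"
    using xs(3) ys \<open>y \<noteq> x\<close> by (cases ys) simp_all
  then show ?thesis
    using xs(4) ys by (auto simp: successively_Cons)
qed

lemma vmeas_pos: "vmeas x > 0"
proof -
  obtain y where y: "x \<sim> y" using ex_adj by blast
  have "w x y = (\<Sum>\<^sub>\<infinity>z\<in>{y}. w x z)" by simp
  also have "\<dots> \<le> vmeas x" unfolding vmeas_def
    using w_summable[of x] y w_pos by (intro infsum_mono_neutral) (auto intro: less_imp_le)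
  finally show ?thesis using w_pos[OF y] by linarith
qed

lemma trans_prob_nonneg: "trans_prob x y \<ge> 0"
  using w_pos[of x y] vmeas_pos[of x] by (auto simp: trans_prob_def)

lemma trans_prob_has_sum: "(trans_prob x has_sum 1) UNIV"
proof -
  have "(w x has_sum vmeas x) {y. x \<sim> y}"
    using w_summable unfolding vmeas_def by simp
  then have "((\<lambda>y. w x y * (1 / vmeas x)) has_sum vmeas x * (1 / vmeas x)) {y. x \<sim> y}"
    by (rule has_sum_cmult_left)
  then have "((\<lambda>y. w x y / vmeas x) has_sum 1) {y. x \<sim> y}"
    using vmeas_pos[of x] by simp
  then show ?thesis
    by (rule has_sum_cong_neutral[THEN iffD1, rotated -1]) (auto simp: trans_prob_def)
qed

lemma trans_prob_nn_integral: "(\<integral>\<^sup>+y. ennreal (trans_prob x y) \<partial>count_space UNIV) = 1"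
proof -
  have s: "trans_prob x summable_on UNIV" and i: "infsum (trans_prob x) UNIV = 1"
    using trans_prob_has_sum[of x] by (auto simp: summable_on_def infsumI)
  have a: "Infinite_Set_Sum.abs_summable_on (trans_prob x) UNIV"
    using s trans_prob_nonneg by (simp flip: abs_summable_equivalent)
  show ?thesis
    using nn_integral_conv_infsetsum[OF a] trans_prob_nonneg infsetsum_infsum[OF a] i by simp
qed

lemma pmf_trans_prob: "pmf (embed_pmf (trans_prob x)) y = trans_prob x y"
  by (intro pmf_embed_pmf trans_prob_nonneg trans_prob_nn_integral)

lemma Ionescu_Tulcea_walk_kernel: "Ionescu_Tulcea (walk_kernel x) (\<lambda>_. count_space UNIV)"
proof (rule Ionescu_Tulcea.intro)
  fix i :: nat
  show "walk_kernel x i \<in> measurable (Pi\<^sub>M {0..<i} (\<lambda>_. count_space UNIV)) (subprob_algebra (count_space UNIV))"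
  proof (cases i)
    case 0
    then show ?thesis
      by (auto simp: walk_kernel_def[abs_def] intro!: measurable_const measure_pmf_in_subprob_algebra)
  next
    case (Suc m)
    have "(\<lambda>\<omega>. \<omega> m) \<in> measurable (Pi\<^sub>M {0..<i} (\<lambda>_. count_space (UNIV :: 'a set))) (count_space UNIV)"
      using Suc by (intro measurable_component_singleton) auto
    moreover have "(\<lambda>z. measure_pmf (embed_pmf (trans_prob z))) \<in>
        measurable (count_space UNIV) (subprob_algebra (count_space UNIV))"
      by (auto intro!: measure_pmf_in_subprob_algebra)
    ultimately show ?thesis
      unfolding Suc walk_kernel_def[abs_def] by (auto intro: measurable_compose)
  qed
next
  fix i :: nat and \<omega> :: "nat \<Rightarrow> 'a"
  show "prob_space (walk_kernel x i \<omega>)"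
    by (auto simp: walk_kernel_def measure_pmf.prob_space_axioms split: nat.split)
qed

sublocale RW: Ionescu_Tulcea "walk_kernel x" "\<lambda>_. count_space UNIV" for x
  by (rule Ionescu_Tulcea_walk_kernel)

lemma path_law_eq: "path_law x = RW.PF.lim x"
  by (simp add: path_law_def)

lemma space_path_law [simp]: "space (path_law x) = UNIV"
  by (simp add: path_law_eq space_PiM PiE_def extensional_def)

lemma sets_path_law: "sets (path_law x) = sets (Pi\<^sub>M UNIV (\<lambda>_. count_space UNIV))"
  by (simp add: path_law_eq)

lemma prefix_in_sets:
  fixes n :: nat
  shows
  "{\<omega> \<in> space (Pi\<^sub>M {0..<n} (\<lambda>_. count_space UNIV)). \<forall>i<n. \<omega> i = a i}
     \<in> sets (Pi\<^sub>M {0..<n} (\<lambda>_. count_space (UNIV :: 'a set)))"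
proof -
  have "{\<omega> \<in> space (Pi\<^sub>M {0..<n} (\<lambda>_. count_space UNIV)). \<forall>i<n. \<omega> i = a i}
      = Pi\<^sub>E {0..<n} (\<lambda>i. {a i})"
    by (auto simp: space_PiM PiE_iff extensional_def)
  then show ?thesis by (auto intro!: sets_PiM_I_finite)
qed

lemma path_law_prefix:
  "emeasure (path_law x) {\<omega>. \<forall>i<n. \<omega> i = a i} =
     emeasure (RW.C x 0 n (\<lambda>_. undefined))
       {\<omega> \<in> space (Pi\<^sub>M {0..<n} (\<lambda>_. count_space UNIV)). \<forall>i<n. \<omega> i = a i}"
  (is "_ = emeasure _ ?X")
proof -
  have "{\<omega>. \<forall>i<n. \<omega> i = a i} = prod_emb UNIV (\<lambda>_. count_space UNIV) {0..<n} ?X"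
    by (auto simp: prod_emb_def space_PiM PiE_def)
  moreover have "prod_emb {0..<n} (\<lambda>_. count_space UNIV) {0..<n} ?X = ?X"
    using prod_emb_id[of ?X "{0..<n}"] prefix_in_sets[of n a, THEN sets.sets_into_space]
    by (auto simp: space_PiM)
  ultimately show ?thesis
    by (simp add: path_law_eq RW.lim prefix_in_sets RW.emeasure_CI[of _ n])
qed

lemma path_law_Suc_aux:
  "emeasure (path_law x) {\<omega>. \<forall>i<Suc n. \<omega> i = a i} =
     emeasure (path_law x) {\<omega>. \<forall>i<n. \<omega> i = a i} * emeasure (walk_kernel x n a) {a n}"
proof -
  let ?S = "\<lambda>n. space (Pi\<^sub>M {0..<n} (\<lambda>_. count_space (UNIV :: 'a set)))"
  let ?X = "\<lambda>n. {\<omega> \<in> ?S n. \<forall>i<n. \<omega> i = a i}"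
  let ?C = "RW.C x 0 n (\<lambda>_. undefined)"
  have u: "(\<lambda>_. undefined) \<in> ?S 0" by (simp add: space_PiM PiE_iff extensional_def)
  have sp: "space ?C = ?S n" and st: "sets ?C = sets (Pi\<^sub>M {0..<n} (\<lambda>_. count_space UNIV))"
    using RW.space_C[OF u] RW.sets_C[OF u] by auto
  have eP: "emeasure (RW.eP x n \<omega>) (?X (Suc n)) =
      emeasure (walk_kernel x n a) {a n} * indicator (?X n) \<omega>" if \<omega>: "\<omega> \<in> ?S n" for \<omega>
  proof -
    have mem: "fun_upd \<omega> n z \<in> ?S (Suc n)" for z
      using \<omega> by (auto simp: space_PiM PiE_iff extensional_def)
    have "(\<lambda>z. fun_upd \<omega> n z) -` ?X (Suc n) = (if \<omega> \<in> ?X n then {a n} else {})"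
      using \<omega> mem by (auto simp: less_Suc_eq)
    moreover have "walk_kernel x n \<omega> = walk_kernel x n a" if "\<omega> \<in> ?X n"
      using that by (auto simp: walk_kernel_def split: nat.split)
    ultimately show ?thesis
      by (simp add: RW.emeasure_eP[OF \<omega> prefix_in_sets])
  qed
  have "emeasure (path_law x) {\<omega>. \<forall>i<Suc n. \<omega> i = a i} =
      emeasure (?C \<bind> RW.eP x n) (?X (Suc n))"
    by (simp add: path_law_prefix)
  also have "\<dots> = (\<integral>\<^sup>+\<omega>. emeasure (RW.eP x n \<omega>) (?X (Suc n)) \<partial>?C)"
    using sp st RW.measurable_eP[of x n] RW.prob_space_C[OF u, of x n] prob_space.not_empty
    by (intro emeasure_bind[OF _ _ prefix_in_sets]) (auto simp: measurable_cong_sets[OF st refl])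
  also have "\<dots> = (\<integral>\<^sup>+\<omega>. emeasure (walk_kernel x n a) {a n} * indicator (?X n) \<omega> \<partial>?C)"
    by (intro nn_integral_cong) (simp only: sp eP)
  also have "\<dots> = emeasure (walk_kernel x n a) {a n} * emeasure ?C (?X n)"
    by (rule nn_integral_cmult_indicator) (simp only: st prefix_in_sets)
  finally show ?thesis by (simp add: path_law_prefix mult.commute)
qed

lemma prob_space_path_law: "prob_space (path_law x)"
proof (intro prob_spaceI)
  have "(\<lambda>_. undefined) \<in> space (Pi\<^sub>M {0..<0} (\<lambda>_. count_space (UNIV :: 'a set)))"
    by (simp add: space_PiM PiE_iff extensional_def)
  then have "prob_space (RW.C x 0 0 (\<lambda>_. undefined))" by (rule RW.prob_space_C)
  from prob_space.emeasure_space_1[OF this]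
  show "emeasure (path_law x) (space (path_law x)) = 1"
    using path_law_prefix[of x 0] by (simp del: RW.C.simps) (simp add: space_PiM)
qed

lemma path_law_0: "emeasure (path_law x) {\<omega>. \<omega> 0 = x} = 1"
  using path_law_Suc_aux[of x 0 "\<lambda>_. x"] prob_space.emeasure_space_1[OF prob_space_path_law, of x]
  by (simp add: walk_kernel_def emeasure_pmf_single)

lemma path_law_Suc:
  "emeasure (path_law x) {\<omega>. \<forall>i\<le>Suc n. \<omega> i = a i} =
     emeasure (path_law x) {\<omega>. \<forall>i\<le>n. \<omega> i = a i} * ennreal (trans_prob (a n) (a (Suc n)))"
  using path_law_Suc_aux[of x "Suc n" a]
  by (simp add: less_Suc_eq_le walk_kernel_def emeasure_pmf_single pmf_trans_prob)

lemma finite_neighbours: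
  assumes cond_p0
  shows "finite {y. x \<sim> y}"
proof -
  obtain p0 where p0: "p0 > 0" "\<And>x y. x \<sim> y \<Longrightarrow> trans_prob x y \<ge> p0"
    using assms unfolding cond_p0_def by blast
  show ?thesis
  proof (rule finite_if_finite_subsets_card_bdd[THEN conjunct1])
    fix F assume F: "F \<subseteq> {y. x \<sim> y}" "finite F"
    have "real (card F) * p0 \<le> sum (trans_prob x) F"
      using F p0 by (intro sum_bounded_below) auto
    also have "\<dots> \<le> 1"
      using finite_sum_le_has_sum[OF trans_prob_has_sum] F trans_prob_nonneg by auto
    finally have "real (card F) \<le> 1 / p0"
      using p0(1) by (simp add: field_simps)
    then show "card F \<le> nat \<lceil>1 / p0\<rceil>" by linarith
  qed
qed

lemma walk_snoc:
  assumes "walk_betw x xs y" "length xs = Suc (Suc n)"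
  shows "\<exists>z. walk_betw x (butlast xs) z \<and> length (butlast xs) = Suc n \<and> z \<sim> y"
proof -
  obtain ys where ys: "xs = ys @ [y]" "length ys = Suc n"
    using assms by (cases xs rule: rev_cases) (auto simp: walk_betw_def)
  then have "ys \<noteq> []" by auto
  then show ?thesis
    using assms ys by (intro exI[of _ "last ys"]) (auto simp: walk_betw_def successively_append_iff)
qed

lemma finite_walks:
  assumes cond_p0
  shows "finite {xs. \<exists>y. walk_betw x xs y \<and> length xs = Suc n}"
proof (induction n)
  case 0
  have "{xs. \<exists>y. walk_betw x xs y \<and> length xs = Suc 0} \<subseteq> {[x]}"
    by (auto simp: walk_betw_def length_Suc_conv)
  then show ?case by (rule finite_subset) simp
next
  case (Suc n)
  let ?W = "{xs. \<exists>y. walk_betw x xs y \<and> length xs = Suc n}"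
  have "{xs. \<exists>y. walk_betw x xs y \<and> length xs = Suc (Suc n)} \<subseteq>
      (\<Union>ys\<in>?W. (\<lambda>y. ys @ [y]) ` {y. last ys \<sim> y})"
  proof safe
    fix xs y assume *: "walk_betw x xs y" "length xs = Suc (Suc n)"
    obtain z where z: "walk_betw x (butlast xs) z" "length (butlast xs) = Suc n" "z \<sim> y"
      using walk_snoc[OF *] by blast
    have "last (butlast xs) = z" "xs = butlast xs @ [y]"
      using z(1) * by (auto simp: walk_betw_def)
    with z show "xs \<in> (\<Union>ys\<in>?W. (\<lambda>y. ys @ [y]) ` {y. last ys \<sim> y})" by blast
  qed
  then show ?case
    by (rule finite_subset) (intro finite_UN_I Suc finite_imageI finite_neighbours assms)
qed

lemma gdist_walk: "\<exists>xs. walk_betw x xs y \<and> length xs = Suc (gdist x y)"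
proof -
  obtain xs where xs: "walk_betw x xs y"
    using connected unfolding walk_betw_def by blast
  then have "length xs = Suc (length xs - 1)"
    unfolding walk_betw_def by (cases xs) simp_all
  with xs have "\<exists>n xs. walk_betw x xs y \<and> length xs = Suc n" by blast
  then show ?thesis
    unfolding gdist_def by (rule LeastI_ex)
qed

lemma finite_geod:
  assumes cond_p0
  shows "finite (geod x y)"
proof -
  have "geod x y \<subseteq> (\<Union>xs\<in>{xs. \<exists>y'. walk_betw x xs y' \<and> length xs = Suc (gdist x y)}. set xs)"
    by (auto simp: geod_def)
  then show ?thesis
    by (rule finite_subset) (intro finite_UN_I finite_walks assms finite_set)
qed

lemma finite_gball:
  assumes cond_p0
  shows "finite (gball x R)"
proof -
  have "gball x R \<subseteq> (\<Union>n<nat \<lceil>R\<rceil>. last ` {xs. \<exists>y. walk_betw x xs y \<and> length xs = Suc n})"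
  proof
    fix y assume "y \<in> gball x R"
    then have "gdist x y < nat \<lceil>R\<rceil>"
      unfolding gball_def by simp linarith
    moreover obtain xs where xs: "walk_betw x xs y" "length xs = Suc (gdist x y)"
      using gdist_walk by blast
    moreover have "y = last xs" using xs by (simp add: walk_betw_def)
    ultimately show "y \<in> (\<Union>n<nat \<lceil>R\<rceil>. last ` {xs. \<exists>y. walk_betw x xs y \<and> length xs = Suc n})"
      by blast
  qed
  then show ?thesis
    by (rule finite_subset) (intro finite_UN_I finite_imageI finite_walks assms finite_lessThan)
qed

end

end

theory Submission
  imports Defs
begin

text \<open>
  Start the walk at \<open>y\<close> and use reversibility: if \<open>x\<close> is hit by time \<open>n\<close> with probability \<open>h\<close>, then
  \<open>heat_kernel2 n x y\<close> is at least \<open>h\<close> times the minimum over \<open>j \<le> n\<close> of the diagonal values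
  \<open>heat_kernel2 j x x\<close>, and the latter are at least \<open>c / V(x, e(x, n))\<close> by Cauchy-Schwarz and the
  condition on \<open>max_mean_exit\<close>.

  To bound \<open>h\<close>, follow a chain of \<open>l\<close> balls along a geodesic from \<open>y\<close> to \<open>x\<close>. By the elliptic
  Harnack inequality, applied to Green functions, each ball is reached from the previous one before
  the walk leaves a larger ball with probability bounded below. By Markov's inequality and the
  choice of \<open>l\<close>, this happens within time \<open>n / (2 l)\<close>. Once the walk is within distance \<open>r\<close> of \<open>x\<close>,
  the same argument on balls that shrink geometrically to \<open>x\<close> costs a power of \<open>r\<close>; it takes time
  comparable to the first step alone, because mean exit times grow at least geometrically in the scale.
\<close>

text \<open>Condition (p_0) bounds the degrees, so balls are finite. Survival, hitting and Green
  quantities are then built from finite averages iterated on finite sets; the trajectory measure is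
  linked to them afterwards, through cylinder sets. Cauchy-Schwarz controls return probabilities at
  even times only, while \<open>x\<close> may be hit at any time; this is why two consecutive times
  are added. Harnack chaining needs balls of radius at least 2, so a chain of balls makes sense only
  if \<open>d / l\<close> is not too small. For \<open>d / l < 48\<close> the walk simply follows a
  geodesic. The factor \<open>r^D\<close> has this origin: about \<open>log 4 r\<close> shrinking
  scales separate a ball of radius comparable to \<open>r\<close> from its centre, each costs a
  fixed factor \<open>c1\<close>, and \<open>c1\<close> to the power \<open>log 4 r\<close> is a
  power of \<open>r\<close>. The scale is \<open>b\<close>, about \<open>d / (24 l)\<close>, and
  exits from balls of radius \<open>80 b\<close> are timed. As \<open>80 / 24 < 9\<close>, these are
  covered by the condition defining \<open>l_9\<close>. That condition is used with
  \<open>s = n / 2\<close>, so the chain takes half of the time and the approach to \<open>x\<close>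
  has the other half.\<close>

context weighted_graph
begin

section \<open>Graph distance, geodesics and reversibility\<close>

lemma gdist_le:
  assumes "walk_betw x xs y" "length xs = Suc n"
  shows "gdist x y \<le> n"
  unfolding gdist_def by (rule Least_le) (use assms in blast)

lemma gdist_refl [simp]: "gdist x x = 0"
  using gdist_le[of x "[x]" x 0] by (simp add: walk_betw_def)

lemma gdist_eq_0_iff [simp]: "gdist x y = 0 \<longleftrightarrow> x = y"
proof
  assume "gdist x y = 0"
  then show "x = y"
    using gdist_walk[of x y] by (auto simp: walk_betw_def length_Suc_conv)
qed simp

lemma gdist_adj: "x \<sim> y \<Longrightarrow> gdist x y \<le> 1"
  using gdist_le[of x "[x, y]" y 1] by (simp add: walk_betw_def)

lemma gdist_triangle: "gdist x z \<le> gdist x y + gdist y z"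
proof -
  obtain xs where xs: "walk_betw x xs y" "length xs = Suc (gdist x y)"
    using gdist_walk by blast
  obtain ys where ys: "walk_betw y ys z" "length ys = Suc (gdist y z)"
    using gdist_walk by blast
  obtain ys' where ys': "ys = y # ys'"
    using ys by (cases ys) (auto simp: walk_betw_def)
  have "walk_betw x (xs @ ys') z"
    using xs ys unfolding ys' walk_betw_def
    by (cases ys') (auto simp: successively_append_iff)
  then show ?thesis
    using xs ys ys' by (intro gdist_le) auto
qed

lemma gdist_sym: "gdist x y = gdist y x"
proof -
  have *: "gdist x y \<le> gdist y x" for x y
  proof -
    obtain xs where xs: "walk_betw y xs x" "length xs = Suc (gdist y x)"
      using gdist_walk by blast
    have "successively (\<lambda>a b. b \<sim> a) xs"
      using xs by (auto simp: walk_betw_def intro: successively_mono adj_sym)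
    then have "walk_betw x (rev xs) y"
      using xs by (auto simp: walk_betw_def hd_rev last_rev)
    then show ?thesis
      using xs by (intro gdist_le[of _ "rev xs"]) auto
  qed
  show ?thesis using *[of x y] *[of y x] by simp
qed

lemma geodesic:
  obtains \<gamma> where "\<gamma> 0 = x" "\<gamma> (gdist x y) = y"
    "\<And>i. i \<le> gdist x y \<Longrightarrow> \<gamma> i \<in> geod x y"
    "\<And>i j. i \<le> j \<Longrightarrow> j \<le> gdist x y \<Longrightarrow> gdist (\<gamma> i) (\<gamma> j) = j - i"
proof -
  obtain xs where xs: "walk_betw x xs y" "length xs = Suc (gdist x y)"
    using gdist_walk by blast
  let ?d = "gdist x y"
  have nth: "xs ! 0 = x" "xs ! ?d = y"
    using xs hd_conv_nth[of xs] last_conv_nth[of xs] unfolding walk_betw_def by auto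
  have le: "gdist (xs ! i) (xs ! (i + k)) \<le> k" if "i + k \<le> ?d" for i k
    using that
  proof (induction k)
    case (Suc k)
    have "xs ! (i + k) \<sim> xs ! Suc (i + k)"
      using xs Suc.prems unfolding walk_betw_def successively_conv_nth by auto
    then show ?case
      using gdist_triangle[of "xs ! i" "xs ! (i + Suc k)" "xs ! (i + k)"]
        gdist_adj[of "xs ! (i + k)" "xs ! (i + Suc k)"] Suc by auto
  qed simp
  show ?thesis
  proof (rule that[of "\<lambda>i. xs ! i"])
    show "xs ! i \<in> geod x y" if "i \<le> ?d" for i
      using that xs unfolding geod_def by (auto intro!: exI[of _ xs])
    show "gdist (xs ! i) (xs ! j) = j - i" if "i \<le> j" "j \<le> ?d" for i j
      using le[of i "j - i"] le[of 0 i] le[of j "?d - j"] that nth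
        gdist_triangle[of x y "xs ! i"] gdist_triangle[of "xs ! i" y "xs ! j"]
      by auto
  qed (use nth in auto)
qed

lemma closer_neighbour:
  assumes "x \<noteq> o'"
  obtains y where "x \<sim> y" "Suc (gdist y o') = gdist x o'"
proof -
  obtain xs where xs: "walk_betw x xs o'" "length xs = Suc (gdist x o')"
    using gdist_walk by blast
  then obtain y ys where ys: "xs = x # y # ys"
    using assms by (cases xs; cases "tl xs") (auto simp: walk_betw_def)
  have "x \<sim> y" "walk_betw y (y # ys) o'"
    using xs ys by (auto simp: walk_betw_def successively_Cons)
  moreover from this have "gdist y o' \<le> length ys"
    by (intro gdist_le) auto
  ultimately show ?thesis
    using that gdist_triangle[of x o' y] gdist_adj[of x y] xs ys by force
qed

lemma trans_prob_sym: "vmeas x * trans_prob x y = vmeas y * trans_prob y x"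
  using adj_sym[of x y] adj_sym[of y x] w_sym[of x y] vmeas_pos[of x] vmeas_pos[of y]
  by (auto simp: trans_prob_def)

lemma gball_mono: "R \<le> R' \<Longrightarrow> gball x R \<subseteq> gball x R'"
  by (auto simp: gball_def)

lemma self_in_gball: "R > 0 \<Longrightarrow> x \<in> gball x R"
  by (simp add: gball_def)

end

locale p0_graph = weighted_graph adj w
  for adj :: "'a \<Rightarrow> 'a \<Rightarrow> bool" (infix \<open>\<sim>\<close> 50) and w :: "'a \<Rightarrow> 'a \<Rightarrow> real" +
  fixes p0 :: real
  assumes p0_pos: "p0 > 0"
    and p0_le: "x \<sim> y \<Longrightarrow> p0 \<le> trans_prob x y"
begin

lemma cond_p0: cond_p0
  using p0_pos p0_le unfolding cond_p0_def by blast

lemmas finite_nbrs [simp] = finite_neighbours[OF cond_p0]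
lemmas finite_ball [simp] = finite_gball[OF cond_p0]

subsection \<open>The Markov operator\<close>

definition avg :: "('a \<Rightarrow> real) \<Rightarrow> 'a \<Rightarrow> real" where
  "avg f x = (\<Sum>y | x \<sim> y. trans_prob x y * f y)"

definition kil :: "'a set \<Rightarrow> ('a \<Rightarrow> real) \<Rightarrow> 'a \<Rightarrow> real" where
  "kil A f x = (if x \<in> A then avg f x else 0)"

text \<open>
  In the paper's notation, \<open>surv A n x\<close> is the probability of \<open>T\<^sub>A > n\<close> under \<open>P\<^sub>x\<close>, and \<open>EE A x\<close>
  below is the expectation of \<open>T\<^sub>A\<close>; see \<open>measure_stay\<close> and \<open>mean_exit_from_eq\<close>.
\<close>

definition surv :: "'a set \<Rightarrow> nat \<Rightarrow> 'a \<Rightarrow> real" where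
  "surv A n = (kil A ^^ n) (indicator A)"

lemma avg_has_sum: "((\<lambda>z. trans_prob x z * f z) has_sum avg f x) UNIV"
proof -
  have "((\<lambda>z. trans_prob x z * f z) has_sum avg f x) {y. x \<sim> y}"
    unfolding avg_def by (rule has_sum_finite) simp
  then show ?thesis
    by (rule has_sum_cong_neutral[THEN iffD1, rotated -1]) (auto simp: trans_prob_def)
qed

lemma harmonic_on_iff: "harmonic_on u A \<longleftrightarrow> (\<forall>y\<in>A. avg u y = u y)"
  unfolding harmonic_on_def using avg_has_sum has_sum_unique by metis

lemma avg_const [simp]: "avg (\<lambda>_. c) x = c"
  using has_sum_unique[OF avg_has_sum[of x "\<lambda>_. c"] has_sum_cmult_left[OF trans_prob_has_sum, of x c]]
  by simp

lemma avg_mono: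
  assumes "\<And>y. x \<sim> y \<Longrightarrow> f y \<le> g y"
  shows "avg f x \<le> avg g x"
  unfolding avg_def using assms trans_prob_nonneg by (intro sum_mono mult_left_mono) auto

lemma avg_cong:
  assumes "\<And>y. x \<sim> y \<Longrightarrow> f y = g y"
  shows "avg f x = avg g x"
  using avg_mono[of x f g] avg_mono[of x g f] assms by force

lemma avg_add: "avg (\<lambda>y. f y + g y) x = avg f x + avg g x"
  by (simp add: avg_def algebra_simps sum.distrib)

lemma avg_diff: "avg (\<lambda>y. f y - g y) x = avg f x - avg g x"
  by (simp add: avg_def algebra_simps sum_subtractf)

lemma avg_multc: "avg (\<lambda>y. f y * c) x = avg f x * c"
  unfolding avg_def sum_distrib_right by (intro sum.cong) auto

lemma avg_cmult: "avg (\<lambda>y. c * f y) x = c * avg f x"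
  using avg_multc[of f c x] by (simp add: mult.commute)

lemma avg_sum: "avg (\<lambda>y. \<Sum>i\<in>I. f i y) x = (\<Sum>i\<in>I. avg (f i) x)"
  unfolding avg_def by (subst sum.swap) (simp add: sum_distrib_left)

lemma avg_nonneg: "(\<And>y. x \<sim> y \<Longrightarrow> f y \<ge> 0) \<Longrightarrow> avg f x \<ge> 0"
  using avg_mono[of x "\<lambda>_. 0" f] by simp

lemma avg_ge:
  assumes "x \<sim> y" "\<And>y. f y \<ge> 0"
  shows "avg f x \<ge> p0 * f y"
proof -
  have "p0 * f y \<le> trans_prob x y * f y"
    using assms p0_le by (intro mult_right_mono) auto
  also have "\<dots> \<le> avg f x"
    unfolding avg_def using assms trans_prob_nonneg
    by (intro member_le_sum) auto
  finally show ?thesis .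
qed

lemma avg_sums:
  assumes "\<And>y. (\<lambda>n. f n y) sums F y"
  shows "(\<lambda>n. avg (f n) x) sums avg F x"
  unfolding avg_def using assms by (intro sums_sum sums_mult) auto

lemma p0_le_1: "p0 \<le> 1"
proof -
  fix x :: 'a
  obtain y where "x \<sim> y" using ex_adj by blast
  then have "p0 * 1 \<le> avg (\<lambda>_. 1) x" by (rule avg_ge) simp
  then show ?thesis by simp
qed

lemma kil_mono: "(\<And>y. f y \<le> g y) \<Longrightarrow> kil A f x \<le> kil A g x"
  by (auto simp: kil_def intro: avg_mono)

lemma kil_power_nonneg: "(\<And>y. f y \<ge> 0) \<Longrightarrow> (kil A ^^ n) f x \<ge> 0"
  by (induction n arbitrary: x) (auto simp: kil_def intro: avg_nonneg)

lemma kil_power_mono: "(\<And>y. f y \<le> g y) \<Longrightarrow> (kil A ^^ n) f x \<le> (kil A ^^ n) g x"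
  by (induction n arbitrary: x) (auto intro: kil_mono)

lemma kil_power_outside: "x \<notin> A \<Longrightarrow> f x = 0 \<Longrightarrow> (kil A ^^ n) f x = 0"
  by (cases n) (auto simp: kil_def)

lemma surv_0 [simp]: "surv A 0 = indicator A"
  by (simp add: surv_def)

lemma surv_Suc: "surv A (Suc n) x = (if x \<in> A then avg (surv A n) x else 0)"
  by (simp add: surv_def kil_def)

lemma surv_nonneg: "surv A n x \<ge> 0"
  unfolding surv_def by (rule kil_power_nonneg) simp

lemma surv_outside: "x \<notin> A \<Longrightarrow> surv A n x = 0"
  unfolding surv_def by (rule kil_power_outside) auto

lemma surv_le_1: "surv A n x \<le> 1"
proof (induction n arbitrary: x)
  case (Suc n)
  then show ?case
    using avg_mono[of x "surv A n" "\<lambda>_. 1"] by (simp add: surv_Suc)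
qed (simp add: indicator_def)

lemma surv_antimono: "m \<le> n \<Longrightarrow> surv A n x \<le> surv A m x"
proof (induction rule: dec_induct)
  case (step n)
  have "surv A (Suc n) x \<le> surv A n x" for n x
  proof (induction n arbitrary: x)
    case 0
    show ?case
      using avg_mono[of x "indicator A" "\<lambda>_. 1"] by (simp add: surv_Suc indicator_def)
  next
    case (Suc n)
    then show ?case using avg_mono[of x "surv A (Suc n)" "surv A n"]
      by (auto simp: surv_Suc[of _ "Suc n"] surv_Suc[of _ n])
  qed
  then show ?case using step by (meson order_trans)
qed simp

subsection \<open>Mean exit times\<close>

definition EE :: "'a set \<Rightarrow> 'a \<Rightarrow> real" where
  "EE A x = (\<Sum>n. surv A n x)"

text \<open>Comparison with a supersolution by induction on the number of terms. It presupposes no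
  convergence, so it yields both the summability of \<open>surv\<close> and the minimality of
  \<open>EE\<close> in \<open>EE_le\<close>.\<close>

lemma surv_sum_le:
  assumes "\<And>x. f x \<ge> 0" "\<And>x. x \<in> A \<Longrightarrow> 1 + avg f x \<le> f x"
  shows "(\<Sum>n<N. surv A n x) \<le> f x"
proof (induction N arbitrary: x)
  case (Suc N)
  show ?case
  proof (cases "x \<in> A")
    case True
    have "(\<Sum>n<Suc N. surv A n x) = 1 + avg (\<lambda>y. \<Sum>n<N. surv A n y) x"
      using True by (simp add: sum.lessThan_Suc_shift surv_Suc avg_sum del: sum.lessThan_Suc)
    also have "\<dots> \<le> 1 + avg f x"
      using Suc by (intro add_left_mono avg_mono)
    finally show ?thesis using assms(2)[OF True] by simp
  next
    case False
    then show ?thesis using assms(1) by (simp add: surv_outside)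
  qed
qed (use assms in simp)

text \<open>
  With \<open>o\<close> outside \<open>A\<close> and \<open>\<beta>\<close> small, \<open>\<beta> ^ gdist x o\<close> is strictly subharmonic off \<open>o\<close>,
  because one neighbour of \<open>x\<close> is closer to \<open>o\<close>. This makes the mean exit time finite.
\<close>

lemma ex_strict_supersolution:
  assumes "finite A"
  obtains f where "\<And>x. f x \<ge> 0" "\<And>x. x \<in> A \<Longrightarrow> 1 + avg f x \<le> f x"
proof -
  obtain o' where o: "o' \<notin> A"
    using infinite_vertices assms by (metis UNIV_I finite_subset subsetI)
  \<comment> \<open>With \<open>p0 / 2\<close> the closer neighbour alone contributes
    \<open>p0 * \<phi> y = 2 * \<phi> x\<close> to the average. Dividing by
    \<open>\<beta> ^ M\<close>, a lower bound of \<open>\<phi>\<close> on \<open>A\<close>, then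
    makes the drift at least 1.\<close>
  define \<beta> where "\<beta> = p0 / 2"
  have \<beta>: "0 < \<beta>" "\<beta> \<le> 1" using p0_pos p0_le_1 by (auto simp: \<beta>_def)
  define \<phi> where "\<phi> x = \<beta> ^ gdist x o'" for x
  have \<phi>: "0 < \<phi> x" "\<phi> x \<le> 1" for x
    using \<beta> by (auto simp: \<phi>_def intro: power_le_one)
  define M where "M = Max (insert 0 ((\<lambda>x. gdist x o') ` A))"
  define f where "f x = (1 - \<phi> x) / \<beta> ^ M" for x
  have "1 + avg f x \<le> f x" if "x \<in> A" for x
  proof -
    have "x \<noteq> o'" using that o by blast
    then obtain y where y: "x \<sim> y" "Suc (gdist y o') = gdist x o'"
      by (rule closer_neighbour)
    have "2 * \<phi> x = p0 * \<phi> y"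
      using y(2)[symmetric] by (simp add: \<phi>_def \<beta>_def)
    also have "\<dots> \<le> avg \<phi> x"
      using y \<phi> by (intro avg_ge) (auto intro: less_imp_le)
    finally have 1: "2 * \<phi> x \<le> avg \<phi> x" .
    have "gdist x o' \<le> M" unfolding M_def using that assms by (intro Max_ge) auto
    then have 2: "\<beta> ^ M \<le> \<phi> x" unfolding \<phi>_def using \<beta> by (intro power_decreasing) auto
    have "avg f x = avg (\<lambda>y. (1 / \<beta> ^ M) * (1 - \<phi> y)) x"
      by (intro avg_cong) (simp add: f_def)
    also have "\<dots> = (1 / \<beta> ^ M) * (1 - avg \<phi> x)"
      by (simp only: avg_cmult avg_diff avg_const)
    finally have "avg f x = (1 - avg \<phi> x) / \<beta> ^ M" by simp
    then have "f x - avg f x = (avg \<phi> x - \<phi> x) / \<beta> ^ M"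
      by (simp add: f_def diff_divide_distrib)
    also have "\<dots> \<ge> \<beta> ^ M / \<beta> ^ M"
      using 1 2 \<beta> by (intro divide_right_mono) auto
    finally show ?thesis using \<beta> by simp
  qed
  moreover have "f x \<ge> 0" for x using \<phi>(2)[of x] \<beta> by (simp add: f_def)
  ultimately show ?thesis using that by blast
qed

lemma summable_surv:
  assumes "finite A"
  shows "summable (\<lambda>n. surv A n x)"
proof -
  obtain f where f: "\<And>x. f x \<ge> 0" "\<And>x. x \<in> A \<Longrightarrow> 1 + avg f x \<le> f x"
    using ex_strict_supersolution[OF assms] by blast
  show ?thesis
    using surv_sum_le[of f A x] f surv_nonneg by (intro summableI_nonneg_bounded[where x="f x"]) auto
qed

lemma surv_tendsto_0:
  assumes "finite A"
  shows "(\<lambda>n. surv A n x) \<longlonglongrightarrow> 0"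
  using summable_LIMSEQ_zero[OF summable_surv[OF assms]] .

lemma EE_outside: "x \<notin> A \<Longrightarrow> EE A x = 0"
  by (simp add: EE_def surv_outside)

lemma EE_nonneg: "finite A \<Longrightarrow> EE A x \<ge> 0"
  unfolding EE_def by (intro suminf_nonneg summable_surv surv_nonneg)

lemma EE_eq:
  assumes "finite A" "x \<in> A"
  shows "EE A x = 1 + avg (EE A) x"
proof -
  have "(\<lambda>n. avg (surv A n) x) sums avg (EE A) x"
    unfolding EE_def using summable_surv[OF assms(1)] by (intro avg_sums) (rule summable_sums)
  then have "(\<lambda>n. surv A (Suc n) x) sums avg (EE A) x"
    using assms by (simp add: surv_Suc)
  then have "(\<lambda>n. surv A n x) sums (avg (EE A) x + surv A 0 x)"
    by (subst (asm) sums_Suc_iff) simp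
  then show ?thesis
    using assms unfolding EE_def by (simp add: sums_iff)
qed

lemma EE_ge_1: "finite A \<Longrightarrow> x \<in> A \<Longrightarrow> EE A x \<ge> 1"
  using EE_eq avg_nonneg[of x "EE A"] EE_nonneg by simp

lemma EE_le:
  assumes "finite A" "\<And>x. f x \<ge> 0" "\<And>x. x \<in> A \<Longrightarrow> 1 + avg f x \<le> f x"
  shows "EE A x \<le> f x"
  unfolding EE_def using summable_surv[OF assms(1)] surv_sum_le[OF assms(2,3)]
  by (intro suminf_le_const) auto

lemma EE_mono:
  assumes "finite B" "A \<subseteq> B"
  shows "EE A x \<le> EE B x"
  using assms EE_nonneg[of B] EE_eq[of B] by (intro EE_le) (auto intro: finite_subset)

lemma surv_markov:
  assumes "finite A"
  shows "surv A t x * real (Suc t) \<le> EE A x"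
proof -
  have "surv A t x * real (Suc t) = (\<Sum>n<Suc t. surv A t x)" by simp
  also have "\<dots> \<le> (\<Sum>n<Suc t. surv A n x)"
    by (intro sum_mono surv_antimono) auto
  also have "\<dots> \<le> EE A x"
    unfolding EE_def using summable_surv[OF assms] surv_nonneg by (intro sum_le_suminf) auto
  finally show ?thesis .
qed

text \<open>The walk moves by distance at most 1 per step, so it cannot leave the ball before time
  \<open>R\<close>.\<close>

lemma EE_ball_ge: "EE (gball x (real R)) x \<ge> real R"
proof -
  have surv: "gdist y x + n < R \<Longrightarrow> surv (gball x (real R)) n y = 1" for n y
  proof (induction n arbitrary: y)
    case 0
    then show ?case by (simp add: gball_def indicator_def gdist_sym)
  next
    case (Suc n)
    have "surv (gball x (real R)) n z = 1" if "y \<sim> z" for z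
      using that gdist_triangle[of z x y] gdist_adj[OF adj_sym[OF that]] Suc.prems
      by (intro Suc.IH) auto
    then have "avg (surv (gball x (real R)) n) y = avg (\<lambda>_. 1) y"
      by (intro avg_cong) auto
    then show ?case using Suc.prems by (simp add: surv_Suc gball_def gdist_sym[of x y])
  qed
  have "real R = (\<Sum>n<R. surv (gball x (real R)) n x)"
    by (simp add: surv)
  also have "\<dots> \<le> EE (gball x (real R)) x"
    unfolding EE_def using summable_surv[of "gball x (real R)" x] surv_nonneg
    by (intro sum_le_suminf) auto
  finally show ?thesis .
qed

text \<open>Iterating the supersolution property bounds \<open>u\<close> below by \<open>- M\<close>
  times the probability of surviving \<open>n\<close> steps in \<open>A\<close>, which tends to
  0.\<close>

lemma min_principle:
  assumes "finite A" "\<And>x. x \<in> A \<Longrightarrow> avg u x \<le> u x"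
    and bd: "\<And>x. x \<in> gboundary A \<Longrightarrow> u x \<ge> 0" and "x \<in> A"
  shows "u x \<ge> 0"
proof -
  define M where "M = Max (insert 0 ((\<lambda>x. - u x) ` A))"
  have M: "- u y \<le> M" if "y \<in> A" for y
    unfolding M_def using that assms(1) by (intro Max_ge) auto
  have *: "u y \<ge> - M * surv A n y" if "y \<in> A" for n y
    using that
  proof (induction n arbitrary: y)
    case 0
    then show ?case using M[of y] by simp
  next
    case (Suc n)
    have "- M * surv A (Suc n) y = avg (\<lambda>z. - M * surv A n z) y"
      using Suc.prems by (simp only: surv_Suc avg_cmult if_True)
    also have "\<dots> \<le> avg u y"
    proof (rule avg_mono)
      fix z assume z: "y \<sim> z"
      show "- M * surv A n z \<le> u z"
      proof (cases "z \<in> A")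
        case False
        then have "z \<in> gboundary A" using z Suc.prems by (auto simp: gboundary_def)
        then show ?thesis using bd False by (simp add: surv_outside)
      qed (rule Suc.IH)
    qed
    finally show ?case using assms(2)[OF Suc.prems] by simp
  qed
  have "(\<lambda>n. - M * surv A n x) \<longlonglongrightarrow> - M * 0"
    by (intro tendsto_intros surv_tendsto_0 assms)
  then show ?thesis
    using *[OF assms(4)] by (intro LIMSEQ_le_const2[of _ 0 "u x"]) auto
qed

subsection \<open>Green functions\<close>

text \<open>Expected number of visits to \<open>y\<close> before leaving \<open>A\<close>, divided
  by \<open>vmeas y\<close> to make it symmetric. The intersection with \<open>A\<close> makes it
  vanish for poles outside \<open>A\<close>.\<close>

definition green :: "'a set \<Rightarrow> 'a \<Rightarrow> 'a \<Rightarrow> real" where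
  "green A x y = (\<Sum>n. (kil A ^^ n) (indicator ({y} \<inter> A)) x) / vmeas y"

lemma kil_power_le_surv: "(kil A ^^ n) (indicator ({y} \<inter> A)) x \<le> surv A n x"
  unfolding surv_def by (intro kil_power_mono) (auto simp: indicator_def)

lemma summable_kil:
  assumes "finite A"
  shows "summable (\<lambda>n. (kil A ^^ n) (indicator ({y} \<inter> A)) x)"
  using kil_power_le_surv
  by (intro summable_comparison_test'[OF summable_surv[OF assms], of 0])
    (auto simp: kil_power_nonneg)

lemma green_nonneg: "finite A \<Longrightarrow> green A x y \<ge> 0"
  unfolding green_def using vmeas_pos[of y] summable_kil
  by (intro divide_nonneg_nonneg suminf_nonneg) (auto intro: kil_power_nonneg less_imp_le)

lemma green_outside: "x \<notin> A \<Longrightarrow> green A x y = 0"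
  unfolding green_def by (simp add: kil_power_outside)

lemma green_eq:
  assumes "finite A" "x \<in> A"
  shows "green A x y = avg (\<lambda>z. green A z y) x + (if x = y then 1 / vmeas y else 0)"
proof -
  let ?k = "\<lambda>n. (kil A ^^ n) (indicator ({y} \<inter> A))"
  have "(\<lambda>n. avg (?k n) x) sums avg (\<lambda>x. \<Sum>n. ?k n x) x"
    using summable_kil[OF assms(1)] by (intro avg_sums) (rule summable_sums)
  then have "(\<lambda>n. ?k (Suc n) x) sums avg (\<lambda>x. \<Sum>n. ?k n x) x"
    using assms by (simp add: kil_def)
  then have "(\<lambda>n. ?k n x) sums (avg (\<lambda>x. \<Sum>n. ?k n x) x + ?k 0 x)"
    by (subst (asm) sums_Suc_iff) simp
  then have *: "(\<Sum>n. ?k n x) = avg (\<lambda>x. \<Sum>n. ?k n x) x + ?k 0 x"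
    by (simp add: sums_iff)
  have "avg (\<lambda>z. green A z y) x = avg (\<lambda>z. (1 / vmeas y) * (\<Sum>n. ?k n z)) x"
    by (simp add: green_def)
  also have "\<dots> = (1 / vmeas y) * avg (\<lambda>z. \<Sum>n. ?k n z) x"
    by (rule avg_cmult)
  finally show ?thesis
    using * assms by (simp add: green_def add_divide_distrib indicator_def)
qed

lemma kil_eq_sum:
  assumes "finite A" "x \<in> A" "\<And>y. y \<notin> A \<Longrightarrow> f y = 0"
  shows "kil A f x = (\<Sum>y\<in>A. trans_prob x y * f y)"
proof -
  have "kil A f x = (\<Sum>y\<in>{y. x \<sim> y} \<inter> A. trans_prob x y * f y)"
    using assms unfolding kil_def avg_def
    by (simp, intro sum.mono_neutral_right) (auto dest: assms(3))
  also have "\<dots> = (\<Sum>y\<in>A. trans_prob x y * f y)"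
    using assms by (intro sum.mono_neutral_left) (auto simp: trans_prob_def)
  finally show ?thesis .
qed

lemma kil_self_adjoint:
  assumes "finite A" "\<And>y. y \<notin> A \<Longrightarrow> f y = 0" "\<And>y. y \<notin> A \<Longrightarrow> g y = 0"
  shows "(\<Sum>x\<in>A. vmeas x * (kil A f x * g x)) = (\<Sum>x\<in>A. vmeas x * (f x * kil A g x))"
proof -
  have "(\<Sum>x\<in>A. vmeas x * (kil A f x * g x)) = (\<Sum>x\<in>A. \<Sum>y\<in>A. vmeas x * trans_prob x y * f y * g x)"
    using assms by (intro sum.cong) (auto simp: kil_eq_sum sum_distrib_left sum_distrib_right mult_ac)
  also have "\<dots> = (\<Sum>y\<in>A. \<Sum>x\<in>A. vmeas x * trans_prob x y * f y * g x)"
    by (rule sum.swap)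
  also have "\<dots> = (\<Sum>x\<in>A. vmeas x * (f x * kil A g x))"
    using assms
    by (intro sum.cong) (auto simp: trans_prob_sym kil_eq_sum sum_distrib_left sum_distrib_right mult_ac)
  finally show ?thesis .
qed

text \<open>Reversibility survives killing on a finite set. Both the symmetry of Green functions and
  the Cauchy-Schwarz bound on the diagonal rest on this.\<close>

lemma kil_power_self_adjoint:
  assumes "finite A" "\<And>y. y \<notin> A \<Longrightarrow> f y = 0" "\<And>y. y \<notin> A \<Longrightarrow> g y = 0"
  shows "(\<Sum>x\<in>A. vmeas x * ((kil A ^^ n) f x * g x)) = (\<Sum>x\<in>A. vmeas x * (f x * (kil A ^^ n) g x))"
  using assms(3)
proof (induction n arbitrary: g)
  case (Suc n)
  have "(\<Sum>x\<in>A. vmeas x * ((kil A ^^ Suc n) f x * g x)) =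
      (\<Sum>x\<in>A. vmeas x * ((kil A ^^ n) f x * kil A g x))"
    using kil_self_adjoint[OF assms(1), of "(kil A ^^ n) f" g] Suc.prems assms(2)
    by (simp add: kil_power_outside)
  also have "\<dots> = (\<Sum>x\<in>A. vmeas x * (f x * (kil A ^^ n) (kil A g) x))"
    by (rule Suc.IH) (simp add: kil_def)
  finally show ?case by (simp add: funpow_swap1)
qed simp

lemma kil_kernel_sym:
  assumes "finite A" "x \<in> A" "y \<in> A"
  shows "vmeas x * (kil A ^^ n) (indicator {y}) x = vmeas y * (kil A ^^ n) (indicator {x}) y"
proof -
  have *: "(\<Sum>z\<in>A. vmeas z * (g z * indicator {v} z)) = vmeas v * g v" if "v \<in> A" for v g
    using that assms(1) by (simp add: indicator_def sum.delta mult.assoc[symmetric])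
  have "(\<Sum>z\<in>A. vmeas z * ((kil A ^^ n) (indicator {y}) z * indicator {x} z)) =
      (\<Sum>z\<in>A. vmeas z * (indicator {y} z * (kil A ^^ n) (indicator {x}) z))"
    using assms by (intro kil_power_self_adjoint) (auto simp: indicator_def)
  then show ?thesis
    using *[OF assms(2), of "(kil A ^^ n) (indicator {y})"] *[OF assms(3), of "(kil A ^^ n) (indicator {x})"]
    by (simp add: mult.commute[of "indicator _ _"])
qed

lemma green_sym:
  assumes "finite A" "x \<in> A" "y \<in> A"
  shows "green A x y = green A y x"
proof -
  have "(kil A ^^ n) (indicator {y}) x = (vmeas y / vmeas x) * (kil A ^^ n) (indicator {x}) y" for n
    using kil_kernel_sym[OF assms, of n] vmeas_pos[of x] by (simp add: field_simps)
  moreover have "{y} \<inter> A = {y}" "{x} \<inter> A = {x}" using assms by auto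
  ultimately show ?thesis
    using summable_kil[OF assms(1), of x y] assms vmeas_pos[of x] vmeas_pos[of y]
    unfolding green_def by (simp add: suminf_mult field_simps del: times_divide_eq_left)
qed

lemma green_potential:
  fixes \<phi> :: "'a \<Rightarrow> real"
  assumes "finite A" "x \<in> A"
  defines "h \<equiv> \<lambda>x. \<Sum>y\<in>A. green A x y * (vmeas y * \<phi> y)"
  shows "h x = avg h x + \<phi> x"
proof -
  have "avg h x = (\<Sum>y\<in>A. avg (\<lambda>z. green A z y) x * (vmeas y * \<phi> y))"
    by (simp only: h_def avg_sum avg_multc)
  then have "h x - avg h x = (\<Sum>y\<in>A. (if x = y then 1 / vmeas y else 0) * (vmeas y * \<phi> y))"
    by (simp only: h_def sum_subtractf[symmetric] left_diff_distrib[symmetric] green_eq[OF assms(1,2)])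
      (simp only: add_diff_cancel_left')
  also have "\<dots> = \<phi> x"
    using assms vmeas_pos[of x] by (simp add: if_distrib[of "\<lambda>t. t * _"] cong: if_cong)
  finally show ?thesis by simp
qed

text \<open>Both sides vanish off \<open>A\<close> and have the same Laplacian on \<open>A\<close>;
  the minimum principle is applied to the difference with either sign.\<close>

lemma green_representation:
  assumes "finite A" "\<And>x. x \<notin> A \<Longrightarrow> f x = 0"
  shows "f x = (\<Sum>y\<in>A. green A x y * (vmeas y * (f y - avg f y)))"
proof -
  let ?h = "\<lambda>x. (\<Sum>y\<in>A. green A x y * (vmeas y * (f y - avg f y)))"
  have out: "?h x = 0" if "x \<notin> A" for x
    using that by (simp add: green_outside)
  note h = green_potential[OF assms(1), where \<phi> = "\<lambda>y. f y - avg f y"]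
  have "?h x - f x \<ge> 0" if "x \<in> A"
  proof (rule min_principle[OF assms(1) _ _ that, of "\<lambda>x. ?h x - f x"])
    show "avg (\<lambda>x. ?h x - f x) z \<le> ?h z - f z" if "z \<in> A" for z
      using h[OF that] unfolding avg_diff by linarith
  qed (metis (no_types, lifting) gboundary_def mem_Collect_eq out assms(2) diff_self order_refl)
  moreover have "f x - ?h x \<ge> 0" if "x \<in> A"
  proof (rule min_principle[OF assms(1) _ _ that, of "\<lambda>x. f x - ?h x"])
    show "avg (\<lambda>x. f x - ?h x) z \<le> f z - ?h z" if "z \<in> A" for z
      using h[OF that] unfolding avg_diff by linarith
  qed (metis (no_types, lifting) gboundary_def mem_Collect_eq out assms(2) diff_self order_refl)
  ultimately show ?thesis
    using assms(2)[of x] out[of x] by (cases "x \<in> A") linarith+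
qed

text \<open>The probability of reaching \<open>D\<close> before leaving \<open>A\<close>, obtained
  by solving a Dirichlet problem: on \<open>A - D\<close> it is the Green potential of
  \<open>avg (indicator D)\<close>, the chance of entering \<open>D\<close> at the next
  step.\<close>

lemma ex_hitting_probability:
  assumes "finite A" "D \<subseteq> A"
  obtains u where "\<And>x. 0 \<le> u x" "\<And>x. u x \<le> 1" "\<And>x. x \<in> D \<Longrightarrow> u x = 1"
    "\<And>x. x \<notin> A \<Longrightarrow> u x = 0" "\<And>x. x \<in> A - D \<Longrightarrow> avg u x = u x"
proof -
  define B where "B = A - D"
  have fin: "finite B" using assms by (simp add: B_def)
  define h where "h x = (\<Sum>y\<in>B. green B x y * (vmeas y * avg (indicator D) y))" for x
  define u where "u x = indicator D x + h x" for x
  have h_out: "h x = 0" if "x \<notin> B" for x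
    using that by (simp add: h_def green_outside)
  have "h x \<ge> 0" for x
    unfolding h_def using fin vmeas_pos
    by (intro sum_nonneg mult_nonneg_nonneg green_nonneg avg_nonneg) (auto intro: less_imp_le)
  then have nonneg: "u x \<ge> 0" for x by (simp add: u_def)
  have harm: "avg u x = u x" if "x \<in> B" for x
    using green_potential[OF fin that, of "avg (indicator D)"] that
    unfolding u_def by (simp add: avg_add h_def[abs_def] B_def)
  have "1 - u x \<ge> 0" if "x \<in> B" for x
  proof (rule min_principle[OF fin _ _ that])
    show "avg (\<lambda>x. 1 - u x) z \<le> 1 - u z" if "z \<in> B" for z
      using harm[OF that] by (simp add: avg_diff)
    show "0 \<le> 1 - u z" if "z \<in> gboundary B" for z
      using that h_out[of z] by (auto simp: gboundary_def u_def indicator_def)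
  qed
  then have "u x \<le> 1" for x
    using h_out[of x] by (cases "x \<in> B") (auto simp: u_def indicator_def)
  moreover have "u x = 1" if "x \<in> D" for x
    using that h_out[of x] by (simp add: u_def B_def)
  moreover have "u x = 0" if "x \<notin> A" for x
    using that h_out[of x] assms(2) by (auto simp: u_def B_def indicator_def)
  ultimately show ?thesis
    using that[of u] nonneg harm unfolding B_def by blast
qed

subsection \<open>Hitting times\<close>

text \<open>Probability of a visit to \<open>X\<close> by time \<open>n\<close>, encoded by its
  first-step decomposition.\<close>

primrec hit :: "'a set \<Rightarrow> nat \<Rightarrow> 'a \<Rightarrow> real" where
  "hit X 0 = indicator X"
| "hit X (Suc n) = (\<lambda>x. if x \<in> X then 1 else avg (hit X n) x)"

lemma hit_in: "x \<in> X \<Longrightarrow> hit X n x = 1"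
  by (cases n) auto

lemma hit_nonneg: "hit X n x \<ge> 0"
  by (induction n arbitrary: x) (auto intro: avg_nonneg)

lemma hit_le_1: "hit X n x \<le> 1"
proof (induction n arbitrary: x)
  case (Suc n)
  then show ?case using avg_mono[of x "hit X n" "\<lambda>_. 1"] by simp
qed (simp add: indicator_def)

lemma avg_hit_le: "avg (hit X n) x \<le> hit X (Suc n) x"
  using avg_mono[of x "hit X n" "\<lambda>_. 1"] by (simp add: hit_le_1)

lemma hit_mono_time: "m \<le> n \<Longrightarrow> hit X m x \<le> hit X n x"
proof (induction rule: dec_induct)
  case (step n)
  have "hit X n x \<le> hit X (Suc n) x" for n x
  proof (induction n arbitrary: x)
    case 0
    show ?case by (auto simp: indicator_def intro: avg_nonneg)
  next
    case (Suc n)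
    then show ?case using avg_mono[of x "hit X n" "hit X (Suc n)"] by simp
  qed
  then show ?case using step by (meson order_trans)
qed simp

lemma hit_mono_set:
  assumes "X \<subseteq> Y"
  shows "hit X n x \<le> hit Y n x"
proof (induction n arbitrary: x)
  case 0
  show ?case using assms by (auto simp: indicator_def)
next
  case (Suc n)
  show ?case
  proof (cases "x \<in> Y")
    case True
    then show ?thesis using hit_le_1[of X "Suc n" x] by simp
  next
    case False
    then show ?thesis using assms avg_mono[of x "hit X n" "hit Y n"] Suc.IH by auto
  qed
qed

text \<open>The strong Markov property at the entrance time of \<open>D\<close>, reduced to an
  induction on the time allowed for it.\<close>

lemma hit_trans:
  assumes "\<And>v. v \<in> D \<Longrightarrow> m \<le> hit X t v" "m \<ge> 0"
  shows "m * hit D s x \<le> hit X (s + t) x"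
proof (induction s arbitrary: x)
  case 0
  show ?case using assms hit_nonneg by (auto simp: indicator_def)
next
  case (Suc s)
  show ?case
  proof (cases "x \<in> D")
    case True
    then show ?thesis
      using assms(1)[OF True] hit_mono_time[of t "Suc s + t" X x] by (simp only: hit_in) simp
  next
    case False
    then have "m * hit D (Suc s) x = avg (\<lambda>y. m * hit D s y) x"
      by (simp add: avg_cmult)
    also have "\<dots> \<le> avg (hit X (s + t)) x"
      by (intro avg_mono Suc.IH)
    also have "\<dots> \<le> hit X (Suc s + t) x"
      using avg_hit_le by simp
    finally show ?thesis .
  qed
qed

lemma hit_point_ge: "gdist x o' \<le> t \<Longrightarrow> hit {o'} t x \<ge> p0 ^ gdist x o'"
proof (induction t arbitrary: x)
  case (Suc t)
  show ?case
  proof (cases "x = o'")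
    case False
    then obtain y where y: "x \<sim> y" "Suc (gdist y o') = gdist x o'"
      by (rule closer_neighbour)
    have "p0 ^ gdist x o' = p0 * p0 ^ gdist y o'"
      by (simp flip: y(2))
    also have "\<dots> \<le> p0 * hit {o'} t y"
      using y Suc p0_pos by (intro mult_left_mono) auto
    also have "\<dots> \<le> avg (hit {o'} t) x"
      using y hit_nonneg by (intro avg_ge) auto
    finally show ?thesis using False by simp
  qed simp
qed simp

text \<open>If \<open>D\<close> is reached before the exit from \<open>A\<close>, then either this
  happens by time \<open>t\<close> or the walk is still in \<open>A\<close> at time
  \<open>t\<close>.\<close>

lemma hitting_probability_le:
  assumes "\<And>x. u x \<le> 1" "\<And>x. x \<notin> A \<Longrightarrow> u x = 0" "\<And>x. x \<in> A - D \<Longrightarrow> avg u x = u x"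
  shows "u x \<le> hit D t x + surv A t x"
proof (induction t arbitrary: x)
  case 0
  show ?case using assms(1,2)[of x] by (cases "x \<in> A") (auto simp: indicator_def)
next
  case (Suc t)
  consider "x \<in> D" | "x \<notin> A" | "x \<in> A - D" by blast
  then show ?case
  proof cases
    case 1
    then show ?thesis using assms(1)[of x] surv_nonneg[of A "Suc t" x] by simp
  next
    case 2
    then show ?thesis using assms(2) hit_nonneg[of D "Suc t" x] surv_nonneg[of A "Suc t" x] by simp
  next
    case 3
    then have "u x = avg u x" using assms(3) by simp
    also have "\<dots> \<le> avg (\<lambda>y. hit D t y + surv A t y) x"
      by (intro avg_mono Suc.IH)
    finally show ?thesis using 3 by (simp add: avg_add surv_Suc)
  qed
qed

end

text \<open>The two conditions in pointwise form, without maxima and minima. Constants at least 1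
  let exponents be enlarged freely.\<close>

locale harnack_graph = p0_graph adj w p0
  for adj :: "'a \<Rightarrow> 'a \<Rightarrow> bool" (infix \<open>\<sim>\<close> 50) and w :: "'a \<Rightarrow> 'a \<Rightarrow> real" and p0 :: real +
  fixes CE CH :: real
  assumes CE_ge_1: "CE \<ge> 1" and CH_ge_1: "CH \<ge> 1"
    and E_bar: "R > 0 \<Longrightarrow> y \<in> gball x R \<Longrightarrow> EE (gball x R) y \<le> CE * EE (gball x R) x"
    and harnack: "R > 0 \<Longrightarrow> (\<And>z. u z \<ge> 0) \<Longrightarrow> (\<And>y. y \<in> gball x (2 * R) \<Longrightarrow> avg u y = u y) \<Longrightarrow>
      a \<in> gball x R \<Longrightarrow> b \<in> gball x R \<Longrightarrow> u a \<le> CH * u b"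
begin

subsection \<open>Growth of mean exit times\<close>

text \<open>The walk leaves the inner ball at some \<open>z\<close> at distance exactly
  \<open>R\<close>. The ball of radius \<open>2 * R + 1\<close> around \<open>z\<close> contains the
  inner ball and lies in the outer one, so by \<open>E_bar\<close> the exit from \<open>z\<close>
  still takes at least the fraction \<open>1 / CE\<close> of the inner mean exit time. The minimum
  principle carries this from the boundary to \<open>x\<close>.\<close>

lemma EE_growth:
  assumes "R \<ge> 1"
  shows "EE (gball x (real (3 * R + 2))) x \<ge> (1 + 1 / CE) * EE (gball x (real R)) x"
proof -
  let ?A = "gball x (real R)" and ?B = "gball x (real (3 * R + 2))"
  define m where "m = EE ?A x / CE"
  have bd: "EE ?B z \<ge> m" if "z \<in> gboundary ?A" for z
  proof -
    obtain y where y: "gdist x y < R" "y \<sim> z" "\<not> gdist x z < R"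
      using \<open>z \<in> gboundary ?A\<close> unfolding gboundary_def gball_def mem_Collect_eq of_nat_less_iff by blast
    then have z: "gdist x z = R"
      using gdist_triangle[of x z y] gdist_adj[of y z] by auto
    let ?Z = "gball z (real (2 * R + 1))"
    have "?A \<subseteq> ?Z"
    proof
      fix v assume "v \<in> ?A"
      then show "v \<in> ?Z"
        using gdist_triangle[of z v x] z gdist_sym[of x z] by (auto simp: gball_def)
    qed
    then have "EE ?A x \<le> EE ?Z x" by (intro EE_mono) auto
    also have "\<dots> \<le> CE * EE ?Z z"
      using z assms gdist_sym[of x z] by (intro E_bar) (auto simp: gball_def)
    also have "EE ?Z z \<le> EE ?B z"
    proof (rule EE_mono)
      show "?Z \<subseteq> ?B"
      proof
        fix v assume "v \<in> ?Z"
        then show "v \<in> ?B"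
          using gdist_triangle[of x v z] z by (auto simp: gball_def)
      qed
    qed simp
    finally show ?thesis
      using CE_ge_1 by (simp add: m_def field_simps)
  qed
  have sub: "?A \<subseteq> ?B" by (intro gball_mono) simp
  have "0 \<le> EE ?B x - EE ?A x - m"
  proof (rule min_principle[of ?A "\<lambda>z. EE ?B z - EE ?A z - m"])
    show "avg (\<lambda>z. EE ?B z - EE ?A z - m) z \<le> EE ?B z - EE ?A z - m" if "z \<in> ?A" for z
      using EE_eq[of ?A z] EE_eq[of ?B z] that sub by (auto simp: avg_diff)
    show "0 \<le> EE ?B z - EE ?A z - m" if "z \<in> gboundary ?A" for z
      using bd[OF that] that EE_outside[of z ?A] by (auto simp: gboundary_def)
  qed (use assms in \<open>auto simp: self_in_gball\<close>)
  then show ?thesis by (simp add: m_def algebra_simps)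
qed

subsection \<open>Comparison of Green functions\<close>

lemma gdist_path_le:
  assumes "\<And>i. i < m \<Longrightarrow> gdist (\<gamma> i) (\<gamma> (Suc i)) \<le> 1" "i + k \<le> m"
  shows "gdist (\<gamma> i) (\<gamma> (i + k)) \<le> k"
  using assms(2)
proof (induction k)
  case (Suc k)
  then show ?case
    using gdist_triangle[of "\<gamma> i" "\<gamma> (i + Suc k)" "\<gamma> (i + k)"] assms(1)[of "i + k"] by force
qed simp

text \<open>Balls are open, so one application of Harnack advances by \<open>b - 1\<close>. Since
  \<open>b <= 2 * (b - 1)\<close>, a path of length \<open>j * b\<close> takes at most
  \<open>2 * j\<close> applications.\<close>

lemma harnack_chain:
  assumes "b \<ge> 2" "\<And>i. i < m \<Longrightarrow> gdist (\<gamma> i) (\<gamma> (Suc i)) \<le> 1" "m \<le> j * b"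
    and u: "\<And>z. u z \<ge> 0"
    and harm: "\<And>i y. i \<le> m \<Longrightarrow> gdist (\<gamma> i) y < 2 * b \<Longrightarrow> avg u y = u y"
  shows "u (\<gamma> 0) \<le> CH ^ (2 * j) * u (\<gamma> m) \<and> u (\<gamma> m) \<le> CH ^ (2 * j) * u (\<gamma> 0)"
proof -
  have *: "u (\<gamma> 0) \<le> CH ^ k * u (\<gamma> n) \<and> u (\<gamma> n) \<le> CH ^ k * u (\<gamma> 0)"
    if "n \<le> k * (b - 1)" "n \<le> m" for k n
    using that
  proof (induction k arbitrary: n)
    case (Suc k)
    define s where "s = min n (b - 1)"
    have s: "s \<le> n" "n - s \<le> k * (b - 1)" "s < b" using Suc.prems assms(1) by (auto simp: s_def)
    have IH: "u (\<gamma> 0) \<le> CH ^ k * u (\<gamma> (n - s)) \<and> u (\<gamma> (n - s)) \<le> CH ^ k * u (\<gamma> 0)"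
      using s Suc.prems by (intro Suc.IH) auto
    have d: "gdist (\<gamma> (n - s)) (\<gamma> n) \<le> s"
      using gdist_path_le[where \<gamma> = \<gamma> and m = m and i = "n - s" and k = s] assms(2) s Suc.prems by auto
    have h: "u p \<le> CH * u q" if "p \<in> gball (\<gamma> (n - s)) (real b)" "q \<in> gball (\<gamma> (n - s)) (real b)" for p q
      using assms(1) u that harm[of "n - s"] s Suc.prems
      by (intro harnack[of "real b" u "\<gamma> (n - s)"]) (auto simp: gball_def)
    have "\<gamma> n \<in> gball (\<gamma> (n - s)) (real b)" "\<gamma> (n - s) \<in> gball (\<gamma> (n - s)) (real b)"
      using d s by (auto simp: gball_def)
    then have 1: "u (\<gamma> n) \<le> CH * u (\<gamma> (n - s))" "u (\<gamma> (n - s)) \<le> CH * u (\<gamma> n)"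
      by (blast intro: h)+
    have "u (\<gamma> n) \<le> CH * (CH ^ k * u (\<gamma> 0))"
      using 1(1) IH CH_ge_1 by (meson order_trans mult_left_mono zero_le_one)
    moreover have "u (\<gamma> 0) \<le> CH ^ k * (CH * u (\<gamma> n))"
      using 1(2) IH CH_ge_1 by (meson order_trans mult_left_mono zero_le_one zero_le_power)
    ultimately show ?case by (simp add: mult_ac)
  qed simp
  have "b \<le> 2 * (b - 1)" using assms(1) by auto
  then have "j * b \<le> j * (2 * (b - 1))" by (rule mult_le_mono2)
  then have "m \<le> (2 * j) * (b - 1)" using assms(3) by linarith
  then show ?thesis by (rule *) simp
qed

lemma green_harmonic: "finite A \<Longrightarrow> x \<in> A \<Longrightarrow> x \<noteq> y \<Longrightarrow> avg (\<lambda>z. green A z y) x = green A x y"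
  using green_eq[of A x y] by simp

lemma green_chain:
  assumes "finite A" "b \<ge> 2" "\<And>i. i < m \<Longrightarrow> gdist (\<gamma> i) (\<gamma> (Suc i)) \<le> 1" "m \<le> j * b"
    and "\<And>i. i \<le> m \<Longrightarrow> gdist (\<gamma> i) y \<ge> 2 * b"
    and "\<And>i. i \<le> m \<Longrightarrow> gball (\<gamma> i) (real (2 * b)) \<subseteq> A"
  shows "green A (\<gamma> 0) y \<le> CH ^ (2 * j) * green A (\<gamma> m) y"
    and "green A (\<gamma> m) y \<le> CH ^ (2 * j) * green A (\<gamma> 0) y"
proof -
  have "avg (\<lambda>z. green A z y) v = green A v y" if "i \<le> m" "gdist (\<gamma> i) v < 2 * b" for i v
  proof (rule green_harmonic[OF assms(1)])
    show "v \<in> A" using assms(6)[OF that(1)] that(2) by (auto simp: gball_def)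
    show "v \<noteq> y" using assms(5)[OF that(1)] that(2) by auto
  qed
  then show "green A (\<gamma> 0) y \<le> CH ^ (2 * j) * green A (\<gamma> m) y"
    "green A (\<gamma> m) y \<le> CH ^ (2 * j) * green A (\<gamma> 0) y"
    using harnack_chain[where \<gamma> = \<gamma> and m = m and u = "\<lambda>z. green A z y", OF assms(2,3,4)]
      green_nonneg[OF assms(1)] by auto
qed

lemma gball_subset:
  assumes "gdist x y + k \<le> n"
  shows "gball y (real k) \<subseteq> gball x (real n)"
proof
  fix v assume "v \<in> gball y (real k)"
  then show "v \<in> gball x (real n)"
    using assms gdist_triangle[of x v y] by (simp add: gball_def)
qed

lemma geod_path:
  obtains \<gamma> where "\<gamma> 0 = x" "\<gamma> (gdist x y) = y"
    "\<And>i. i \<le> gdist x y \<Longrightarrow> gdist x (\<gamma> i) = i"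
    "\<And>i. i \<le> gdist x y \<Longrightarrow> gdist (\<gamma> i) y = gdist x y - i"
    "\<And>i. i < gdist x y \<Longrightarrow> gdist (\<gamma> i) (\<gamma> (Suc i)) \<le> 1"
proof -
  obtain \<gamma> where \<gamma>: "\<gamma> 0 = x" "\<gamma> (gdist x y) = y"
    "\<And>i j. i \<le> j \<Longrightarrow> j \<le> gdist x y \<Longrightarrow> gdist (\<gamma> i) (\<gamma> j) = j - i"
    by (rule geodesic[of x y]) blast
  show ?thesis
    using \<gamma>(1,2) \<gamma>(3)[of 0] \<gamma>(3)[of _ "gdist x y"] \<gamma>(3)[of _ "Suc _"] by (intro that[of \<gamma>]) auto
qed

text \<open>From \<open>p\<close> back to \<open>\<gamma> i\<close>, then along a geodesic to
  \<open>q\<close>: two pieces of length at most \<open>2 * b\<close>, both at distance at least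
  \<open>2 * b\<close> from the pole. This gives exponent \<open>4 + 4\<close>, relaxed to the 16
  that the other case of \<open>green_compare\<close> requires.\<close>

lemma green_compare_close:
  assumes A: "finite A" "gball y (real (8 * b)) \<subseteq> A" and b: "b \<ge> 2"
    and q: "gdist y q = 4 * b"
    and \<gamma>: "\<gamma> (4 * b) = p" "\<And>i. i \<le> 4 * b \<Longrightarrow> gdist y (\<gamma> i) = i"
      "\<And>i. i < 4 * b \<Longrightarrow> gdist (\<gamma> i) (\<gamma> (Suc i)) \<le> 1"
    and i: "i \<le> 4 * b" "gdist (\<gamma> i) q < 2 * b"
  shows "green A p y \<le> CH ^ 16 * green A q y" "green A q y \<le> CH ^ 16 * green A p y"
proof -
  have i2: "2 * b \<le> i"
    using gdist_triangle[of y q "\<gamma> i"] q \<gamma>(2)[OF i(1)] i by auto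
  have sub\<gamma>: "gball (\<gamma> (i + k)) (real (2 * b)) \<subseteq> A" if "k \<le> 4 * b - i" for k
    using \<gamma>(2)[of "i + k"] that i(1) by (intro order_trans[OF gball_subset A(2)]) auto
  have far\<gamma>: "2 * b \<le> gdist (\<gamma> (i + k)) y" if "k \<le> 4 * b - i" for k
    using \<gamma>(2)[of "i + k"] that i(1) i2 gdist_sym[of y] by auto
  have 1: "green A (\<gamma> i) y \<le> CH ^ 4 * green A p y" "green A p y \<le> CH ^ 4 * green A (\<gamma> i) y"
    using green_chain[where m = "4 * b - i" and \<gamma> = "\<lambda>k. \<gamma> (i + k)" and j = 2 and y = y,
        OF A(1) b _ _ far\<gamma> sub\<gamma>] \<gamma>(1,3) i(1) i2 by auto
  let ?m = "gdist (\<gamma> i) q"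
  obtain \<delta> where \<delta>: "\<delta> 0 = \<gamma> i" "\<delta> ?m = q"
    "\<And>k. k \<le> ?m \<Longrightarrow> gdist (\<gamma> i) (\<delta> k) = k"
    "\<And>k. k \<le> ?m \<Longrightarrow> gdist (\<delta> k) q = ?m - k"
    "\<And>k. k < ?m \<Longrightarrow> gdist (\<delta> k) (\<delta> (Suc k)) \<le> 1"
    by (rule geod_path[of "\<gamma> i" q]) blast
  have far: "2 * b \<le> gdist (\<delta> k) y" if "k \<le> ?m" for k
    using gdist_triangle[of y q "\<delta> k"] q \<delta>(4)[OF that] i(2) gdist_sym[of y] by auto
  have near: "gball (\<delta> k) (real (2 * b)) \<subseteq> A" if "k \<le> ?m" for k
    using gball_subset[of y "\<delta> k" "2 * b" "8 * b"] gdist_triangle[of y "\<delta> k" "\<gamma> i"]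
      \<gamma>(2)[OF i(1)] \<delta>(3)[OF that] i that A(2) gdist_sym[of "\<gamma> i"] by auto
  have 2: "green A (\<gamma> i) y \<le> CH ^ 4 * green A q y" "green A q y \<le> CH ^ 4 * green A (\<gamma> i) y"
    using green_chain[where m = ?m and \<gamma> = \<delta> and j = 2 and y = y, OF A(1) b \<delta>(5) _ far near] i(2) \<delta>(1,2) by auto
  have pow: "CH ^ 4 * (CH ^ 4 * t) \<le> CH ^ 16 * t" if "t \<ge> 0" for t
    using that power_increasing[of 8 16 CH] CH_ge_1 mult_right_mono[of "CH ^ 8" "CH ^ 16" t]
    by (simp flip: mult.assoc power_add)
  show "green A p y \<le> CH ^ 16 * green A q y"
    using 1(2) 2(1) pow[of "green A q y"] green_nonneg[OF A(1), of q y] CH_ge_1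
      mult_left_mono[OF 2(1), of "CH ^ 4"] by force
  show "green A q y \<le> CH ^ 16 * green A p y"
    using 2(2) 1(1) pow[of "green A p y"] green_nonneg[OF A(1), of p y] CH_ge_1
      mult_left_mono[OF 1(1), of "CH ^ 4"] by force
qed

text \<open>
  Two points \<open>p\<close>, \<open>q\<close> on a sphere around the pole \<open>y\<close>. If each geodesic from \<open>y\<close> to one of them
  keeps away from the other, Harnack along these geodesics gives
  \<open>g(p, y) \<approx> g(p, q) \<approx> g(y, q)\<close>. Otherwise \<open>p\<close> and \<open>q\<close> are joined by a short path
  that keeps away from \<open>y\<close>. No covering of the sphere is needed, hence no volume doubling.
\<close>

lemma green_compare:
  assumes A: "finite A" "gball y (real (8 * b)) \<subseteq> A" and b: "b \<ge> 2"
    and p: "gdist y p = 4 * b" and q: "gdist y q = 4 * b"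
  shows "green A p y \<le> CH ^ 16 * green A q y"
proof -
  obtain \<gamma> where \<gamma>: "\<gamma> 0 = y" "\<gamma> (4 * b) = p" "\<And>i. i \<le> 4 * b \<Longrightarrow> gdist y (\<gamma> i) = i"
    "\<And>i. i < 4 * b \<Longrightarrow> gdist (\<gamma> i) (\<gamma> (Suc i)) \<le> 1"
    using p by (rule_tac geod_path[of y p]) auto
  obtain \<delta> where \<delta>: "\<delta> 0 = y" "\<delta> (4 * b) = q" "\<And>i. i \<le> 4 * b \<Longrightarrow> gdist y (\<delta> i) = i"
    "\<And>i. i < 4 * b \<Longrightarrow> gdist (\<delta> i) (\<delta> (Suc i)) \<le> 1"
    using q by (rule_tac geod_path[of y q]) auto
  consider i where "i \<le> 4 * b" "gdist (\<gamma> i) q < 2 * b" | i where "i \<le> 4 * b" "gdist (\<delta> i) p < 2 * b"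
    | "\<And>i. i \<le> 4 * b \<Longrightarrow> 2 * b \<le> gdist (\<gamma> i) q" "\<And>i. i \<le> 4 * b \<Longrightarrow> 2 * b \<le> gdist (\<delta> i) p"
    by (meson not_le)
  then show ?thesis
  proof cases
    case 1
    then show ?thesis using green_compare_close(1)[OF A b q \<gamma>(2,3,4)] by blast
  next
    case 2
    then show ?thesis using green_compare_close(2)[OF A b p \<delta>(2,3,4)] by blast
  next
    case 3
    have sub: "gball (\<gamma> i) (real (2 * b)) \<subseteq> A" "gball (\<delta> i) (real (2 * b)) \<subseteq> A" if "i \<le> 4 * b" for i
      using \<gamma>(3)[OF that] \<delta>(3)[OF that] that by (intro order_trans[OF gball_subset A(2)]; auto)+
    have in_A: "y \<in> A" "p \<in> A" "q \<in> A"
      using A(2) b p q by (auto simp: gball_def)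
    have 1: "green A y p \<le> CH ^ 8 * green A q p"
      using green_chain(1)[where m = "4 * b" and \<gamma> = \<delta> and j = 4 and y = p, OF A(1) b \<delta>(4) _ 3(2) sub(2)]
        \<delta>(1,2) by simp
    have 2: "green A p q \<le> CH ^ 8 * green A y q"
      using green_chain(2)[where m = "4 * b" and \<gamma> = \<gamma> and j = 4 and y = q, OF A(1) b \<gamma>(4) _ 3(1) sub(1)]
        \<gamma>(1,2) by simp
    have "green A p y \<le> CH ^ 8 * green A p q"
      using 1 green_sym[OF A(1)] in_A by simp
    also have "\<dots> \<le> CH ^ 8 * (CH ^ 8 * green A y q)"
      using 2 CH_ge_1 by (intro mult_left_mono) auto
    also have "\<dots> = CH ^ 16 * green A q y"
      using green_sym[OF A(1)] in_A by (simp flip: mult.assoc power_add)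
    finally show ?thesis .
  qed
qed

text \<open>The point \<open>q\<close> is exchanged for the point on the same sphere of the geodesic
  from \<open>y\<close> to \<open>v\<close>. Chaining outward to \<open>v\<close> covers length at
  most \<open>M * b\<close>, whence the summand \<open>2 * M\<close> in the exponent.\<close>

lemma green_compare_far:
  assumes A: "finite A" "gball y (real ((M + 8) * b)) \<subseteq> A" and b: "b \<ge> 2"
    and q: "gdist y q = 4 * b" and v: "4 * b \<le> gdist y v" "gdist y v \<le> M * b"
  shows "green A q y \<le> CH ^ (16 + 2 * M) * green A v y"
proof -
  let ?d = "gdist y v"
  obtain \<gamma> where \<gamma>: "\<gamma> ?d = v" "\<And>i. i \<le> ?d \<Longrightarrow> gdist y (\<gamma> i) = i"
    "\<And>i. i < ?d \<Longrightarrow> gdist (\<gamma> i) (\<gamma> (Suc i)) \<le> 1"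
    by (rule geod_path[of y v]) blast
  have sub: "gball (\<gamma> i) (real (2 * b)) \<subseteq> A" if "i \<le> ?d" for i
    using gball_subset[of y "\<gamma> i" "2 * b" "(M + 8) * b"] \<gamma>(2)[OF that] that A(2) v
    by (auto simp: algebra_simps)
  have "8 * b \<le> (M + 8) * b" by (rule mult_le_mono1) simp
  then have A': "gball y (real (8 * b)) \<subseteq> A"
    using A(2) gball_mono[of "real (8 * b)" "real ((M + 8) * b)" y] by (metis of_nat_le_iff subset_trans)
  have "green A q y \<le> CH ^ 16 * green A (\<gamma> (4 * b)) y"
    using q v \<gamma>(2) by (intro green_compare[OF A(1) A' b]) auto
  also have "green A (\<gamma> (4 * b)) y \<le> CH ^ (2 * M) * green A v y"
  proof -
    have "2 * b \<le> gdist (\<gamma> (4 * b + k)) y" if "k \<le> ?d - 4 * b" for k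
      using \<gamma>(2)[of "4 * b + k"] that v gdist_sym[of y] by auto
    then show ?thesis
      using green_chain(1)[where m = "?d - 4 * b" and \<gamma> = "\<lambda>k. \<gamma> (4 * b + k)" and j = M and y = y,
          OF A(1) b] \<gamma>(1,3) sub v by auto
  qed
  finally show ?thesis
    using CH_ge_1 by (simp add: power_add mult.assoc)
qed

subsection \<open>Hitting probabilities\<close>

text \<open>Half of the bound \<open>1 / CH ^ 144\<close> from
  \<open>hitting_probability_ge\<close>; \<open>q1\<close> is chosen with
  \<open>CE / q1 = c1\<close>, so that Markov's inequality costs at most the other half.\<close>

definition c1 :: real where "c1 = 1 / (2 * CH ^ 144)"
definition q1 :: real where "q1 = 2 * CE * CH ^ 144"

lemma c1_pos: "c1 > 0" and c1_le_1: "c1 \<le> 1"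
  using CH_ge_1 one_le_power[OF CH_ge_1, of 144] by (auto simp: c1_def divide_simps; linarith)+

lemma q1_ge_1: "q1 \<ge> 1"
  using mult_mono[of 1 "2 * CE" 1 "CH ^ 144"] CE_ge_1 one_le_power[OF CH_ge_1, of 144] by (simp add: q1_def)

definition cball :: "'a \<Rightarrow> nat \<Rightarrow> 'a set" where
  "cball z k = {v. gdist z v \<le> k}"

text \<open>
  In the Green function representation of the hitting probability \<open>u\<close> of the ball of radius
  \<open>4 b\<close> around \<open>z\<close>, only poles at distance exactly \<open>4 b\<close> from \<open>z\<close> contribute, so
  \<open>u v\<close> is compared with \<open>u z = 1\<close> term by term.
\<close>

lemma hitting_probability_ge:
  assumes b: "b \<ge> 2" and v: "8 * b \<le> gdist z v" "gdist z v \<le> 60 * b"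
    and u: "\<And>x. u x \<le> 1" "\<And>x. x \<in> cball z (4 * b) \<Longrightarrow> u x = 1"
      "\<And>x. x \<notin> gball z (real (80 * b)) \<Longrightarrow> u x = 0"
      "\<And>x. x \<in> gball z (real (80 * b)) - cball z (4 * b) \<Longrightarrow> avg u x = u x"
  shows "1 \<le> CH ^ 144 * u v"
proof -
  let ?A = "gball z (real (80 * b))" and ?D = "cball z (4 * b)"
  let ?e = "\<lambda>y. vmeas y * (u y - avg u y)"
  have "green ?A z y * ?e y \<le> CH ^ 144 * (green ?A v y * ?e y)" if "y \<in> ?A" for y
  proof -
    consider "y \<notin> ?D" | "gdist z y < 4 * b" | "gdist z y = 4 * b"
      by (fastforce simp: cball_def)
    then show ?thesis
    proof cases
      case 1
      then show ?thesis using u(4) that by simp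
    next
      case 2
      have "avg u y = avg (\<lambda>_. 1) y"
      proof (rule avg_cong)
        fix x assume "y \<sim> x"
        then show "u x = 1"
          using gdist_triangle[of z x y] gdist_adj[of y x] 2 by (intro u(2)) (auto simp: cball_def)
      qed
      then show ?thesis using u(2)[of y] 2 by (simp add: cball_def)
    next
      case 3
      have "avg u y \<le> 1" using avg_mono[of y u "\<lambda>_. 1"] u(1) by simp
      then have e: "?e y \<ge> 0"
        using u(2)[of y] 3 vmeas_pos[of y] by (simp add: cball_def)
      \<comment> \<open>By the triangle inequality through \<open>z\<close>, the distance from the
        pole to \<open>v\<close> lies between \<open>(8 - 4) * b\<close> and
        \<open>(60 + 4) * b\<close>; and \<open>4 + 64 + 8 <= 80\<close> places the required ball
        inside \<open>?A\<close>.\<close>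
      have "green ?A z y \<le> CH ^ (16 + 2 * 64) * green ?A v y"
      proof (rule green_compare_far[OF _ _ b])
        show "gball y (real ((64 + 8) * b)) \<subseteq> ?A"
          using 3 by (intro gball_subset) simp
        show "4 * b \<le> gdist y v"
          using gdist_triangle[of z v y] 3 v by simp
        show "gdist y v \<le> 64 * b"
          using gdist_triangle[of y v z] 3 v gdist_sym[of y z] by simp
      qed (use 3 gdist_sym[of y z] in auto)
      from mult_right_mono[OF this e] show ?thesis by (simp add: mult.assoc)
    qed
  qed
  then have "(\<Sum>y\<in>?A. green ?A z y * ?e y) \<le> (\<Sum>y\<in>?A. CH ^ 144 * (green ?A v y * ?e y))"
    by (rule sum_mono)
  moreover have "(\<Sum>y\<in>?A. green ?A z y * ?e y) = u z"
    by (rule green_representation[symmetric]) (use u(3) in auto)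
  moreover have "(\<Sum>y\<in>?A. green ?A v y * ?e y) = u v"
    by (rule green_representation[symmetric]) (use u(3) in auto)
  ultimately show ?thesis
    using u(2)[of z] by (simp add: cball_def flip: sum_distrib_left)
qed

abbreviation Ez :: "'a \<Rightarrow> nat \<Rightarrow> real" where
  "Ez z R \<equiv> EE (gball z (real R)) z"

lemma Ez_ge_1: "R > 0 \<Longrightarrow> Ez z R \<ge> 1"
  by (rule EE_ge_1) (auto simp: self_in_gball)

text \<open>Reaching radius \<open>4 * b\<close> before leaving the ball of radius
  \<open>80 * b\<close> has probability at least \<open>2 * c1\<close>; still being inside at time
  \<open>t\<close> has probability at most \<open>c1\<close>. The target has radius
  \<open>8 * b\<close> because starting points nearer to \<open>z\<close> may be too close to the
  poles.\<close>

lemma hit_ball: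
  assumes b: "b \<ge> 2" and v: "gdist z v \<le> 60 * b" and t: "real t \<ge> q1 * Ez z (80 * b)"
  shows "hit (cball z (8 * b)) t v \<ge> c1"
proof (cases "gdist z v \<le> 8 * b")
  case True
  then show ?thesis using c1_le_1 by (simp add: hit_in cball_def)
next
  case False
  let ?A = "gball z (real (80 * b))" and ?D = "cball z (4 * b)"
  have "?D \<subseteq> ?A" using b by (auto simp: cball_def gball_def)
  then obtain u where u: "\<And>x. u x \<le> 1" "\<And>x. x \<in> ?D \<Longrightarrow> u x = 1" "\<And>x. x \<notin> ?A \<Longrightarrow> u x = 0"
    "\<And>x. x \<in> ?A - ?D \<Longrightarrow> avg u x = u x"
    using ex_hitting_probability[of ?A ?D] finite_ball by metis
  have 1: "1 \<le> CH ^ 144 * u v"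
    using False by (intro hitting_probability_ge[OF b _ v u]) auto
  have E1: "Ez z (80 * b) \<ge> 1" using b by (intro Ez_ge_1) auto
  have "surv ?A t v * (q1 * Ez z (80 * b)) \<le> surv ?A t v * real (Suc t)"
    using t surv_nonneg by (intro mult_left_mono) auto
  also have "\<dots> \<le> EE ?A v" by (rule surv_markov) simp
  also have "\<dots> \<le> CE * Ez z (80 * b)"
    using v b by (intro E_bar) (auto simp: gball_def)
  finally have "(surv ?A t v * q1) * Ez z (80 * b) \<le> CE * Ez z (80 * b)"
    by (simp add: mult_ac)
  then have "surv ?A t v * q1 \<le> CE"
    using E1 by (subst (asm) mult_le_cancel_right) auto
  then have "CE * (surv ?A t v * (2 * CH ^ 144)) \<le> CE * 1"
    by (simp add: q1_def mult_ac)
  then have 2: "surv ?A t v * (2 * CH ^ 144) \<le> 1"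
    using CE_ge_1 by (subst (asm) mult_le_cancel_left) auto
  have "u v \<le> hit ?D t v + surv ?A t v"
    by (rule hitting_probability_le) (use u in auto)
  then have "CH ^ 144 * u v \<le> CH ^ 144 * (hit ?D t v + surv ?A t v)"
    using CH_ge_1 by (intro mult_left_mono) auto
  then have "1 \<le> hit ?D t v * (2 * CH ^ 144)"
    using 1 2 by (simp add: algebra_simps)
  then have "c1 \<le> hit ?D t v"
    using CH_ge_1 by (simp add: c1_def field_simps)
  also have "\<dots> \<le> hit (cball z (8 * b)) t v"
    by (intro hit_mono_set) (auto simp: cball_def)
  finally show ?thesis .
qed

text \<open>Spacing \<open>52 * b\<close> plus target radius \<open>8 * b\<close> is the reach
  \<open>60 * b\<close> of \<open>hit_ball\<close>.\<close>

lemma hit_along_chain: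
  assumes b: "b \<ge> 2" and z: "\<And>i. i < l \<Longrightarrow> gdist (z i) (z (Suc i)) \<le> 52 * b"
    and T: "\<And>i. i \<le> l \<Longrightarrow> real T \<ge> q1 * Ez (z i) (80 * b)"
    and m: "m \<ge> 0" "\<And>v. gdist (z l) v \<le> 8 * b \<Longrightarrow> m \<le> hit X t v"
    and v: "gdist (z 0) v \<le> 8 * b"
  shows "c1 ^ l * m \<le> hit X (l * T + t) v"
  using z T m(2) v
proof (induction l arbitrary: z v)
  case (Suc l)
  have IH: "c1 ^ l * m \<le> hit X (l * T + t) y" if "y \<in> cball (z 1) (8 * b)" for y
    using that Suc.prems by (intro Suc.IH[of "\<lambda>i. z (Suc i)"]) (auto simp: cball_def)
  have "c1 \<le> hit (cball (z 1) (8 * b)) T v"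
  proof (rule hit_ball[OF b])
    show "gdist (z 1) v \<le> 60 * b"
      using gdist_triangle[of "z 1" v "z 0"] gdist_sym[of "z 1" "z 0"] Suc.prems(1)[of 0] Suc.prems(4)
      by simp
  qed (use Suc.prems(2)[of 1] in auto)
  then have "c1 ^ Suc l * m \<le> (c1 ^ l * m) * hit (cball (z 1) (8 * b)) T v"
    using c1_pos m(1) mult_left_mono[of c1 "hit (cball (z 1) (8 * b)) T v" "c1 ^ l * m"]
    by (simp add: mult_ac)
  also have "\<dots> \<le> hit X (T + (l * T + t)) v"
    using IH c1_pos m(1) by (intro hit_trans) auto
  finally show ?case by (simp add: algebra_simps)
qed simp

subsection \<open>Hitting a point\<close>

text \<open>
  In \<open>K1\<close>, the summand 56 pays for the base case \<open>b < 8\<close> of \<open>hit_centre\<close>, where \<open>x\<close> is at distance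
  at most 56. By \<open>EE_growth\<close> the time needed at the smaller scale \<open>b div 4\<close> is smaller by a fixed
  proportion of itself; \<open>CE * (q1 + 1)\<close> makes this gain cover the step from scale \<open>b\<close> to \<open>b div 4\<close>.
\<close>

definition K1 :: real where "K1 = 56 + CE * (q1 + 1)"
definition D1 :: real where "D1 = log 4 (1 / c1)"

lemma D1: "D1 > 0" "c1 * 4 powr D1 = 1"
proof -
  have "c1 < 1" using one_le_power[OF CH_ge_1, of 144] by (simp add: c1_def divide_simps)
  then show "D1 > 0" using c1_pos by (simp add: D1_def)
  show "c1 * 4 powr D1 = 1" using c1_pos by (simp add: D1_def)
qed

text \<open>Each passage from scale \<open>b\<close> to \<open>b div 4\<close> costs
  \<open>c1 = 4 powr - D1\<close>, in total a power of \<open>b\<close>. For \<open>b >= 8\<close>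
  one has \<open>b <= 6 * (b div 4)\<close>, so \<open>8 * b\<close> is within the reach of
  \<open>hit_ball\<close> at the smaller scale.\<close>

lemma hit_centre:
  assumes "b \<ge> 1" "gdist x v \<le> 8 * b" "real t \<ge> K1 * Ez x (80 * b)"
  shows "hit {x} t v \<ge> p0 ^ 56 * real b powr - D1"
  using assms
proof (induction b arbitrary: v t rule: less_induct)
  case (less b)
  have E1: "Ez x (80 * b) \<ge> 1" using less.prems by (intro Ez_ge_1) auto
  have K1: "K1 \<ge> 56" using CE_ge_1 q1_ge_1 by (simp add: K1_def)
  show ?case
  proof (cases "b < 8")
    case True
    have "gdist x v \<le> 56" using True less.prems(2) by simp
    moreover have "real t \<ge> 56" using mult_mono[of 56 K1 1 "Ez x (80 * b)"] K1 E1 less.prems(3) by simp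
    ultimately have "p0 ^ gdist v x \<le> hit {x} t v"
      using gdist_sym[of v x] by (intro hit_point_ge) simp
    moreover have "p0 ^ 56 \<le> p0 ^ gdist v x"
      using \<open>gdist x v \<le> 56\<close> gdist_sym[of v x] p0_pos p0_le_1 by (intro power_decreasing) auto
    moreover have "real b powr - D1 \<le> 1"
      using less.prems(1) D1 powr_mono2'[of "- D1" 1 "real b"] by simp
    then have "p0 ^ 56 * real b powr - D1 \<le> p0 ^ 56"
      using p0_pos by (intro mult_left_le) auto
    ultimately show ?thesis by linarith
  next
    case False
    define b' where "b' = b div 4"
    have b': "b' \<ge> 2" "b' < b" "4 * b' \<le> b" "b \<le> 6 * b'"
      using False by (auto simp: b'_def)
    have E1': "Ez x (80 * b') \<ge> 1" using b' by (intro Ez_ge_1) auto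
    define s where "s = nat \<lceil>q1 * Ez x (80 * b')\<rceil>"
    have s: "real s \<ge> q1 * Ez x (80 * b')" "real s \<le> q1 * Ez x (80 * b') + 1"
      using q1_ge_1 E1' by (auto simp: s_def)
    \<comment> \<open>One growth step fits between the scales:
      \<open>3 * (80 * b') + 2 <= 320 * b' <= 80 * b\<close>.\<close>
    have "(1 + 1 / CE) * Ez x (80 * b') \<le> Ez x (3 * (80 * b') + 2)"
      using b' by (intro EE_growth) simp
    also have "\<dots> \<le> Ez x (80 * b)"
      using b' by (intro EE_mono gball_mono) auto
    finally have "K1 * ((1 + 1 / CE) * Ez x (80 * b')) \<le> real t"
      using less.prems(3) K1 mult_left_mono by (smt (verit))
    then have "K1 * Ez x (80 * b') + K1 / CE * Ez x (80 * b') \<le> real t"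
      by (simp add: algebra_simps)
    \<comment> \<open>The \<open>+ 1\<close> absorbs the ceiling in \<open>s\<close>, because mean
      exit times are at least 1.\<close>
    moreover have "K1 / CE \<ge> q1 + 1" using CE_ge_1 by (simp add: K1_def field_simps)
    then have "K1 / CE * Ez x (80 * b') \<ge> (q1 + 1) * Ez x (80 * b')"
      using E1' by (intro mult_right_mono) auto
    ultimately have t: "K1 * Ez x (80 * b') + real s \<le> real t"
      using s(2) E1' by (simp add: algebra_simps)
    then have "s \<le> t" using K1 E1' mult_nonneg_nonneg[of K1 "Ez x (80 * b')"] by linarith
    define m where "m = p0 ^ 56 * real b' powr - D1"
    have "c1 \<le> hit (cball x (8 * b')) s v"
      using less.prems(2) b' s(1) by (intro hit_ball) auto
    then have "m * c1 \<le> m * hit (cball x (8 * b')) s v"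
      using p0_pos by (intro mult_left_mono) (auto simp: m_def)
    also have "\<dots> \<le> hit {x} (s + (t - s)) v"
    proof (rule hit_trans)
      fix y assume "y \<in> cball x (8 * b')"
      then show "m \<le> hit {x} (t - s) y"
        unfolding m_def using b' t \<open>s \<le> t\<close> by (intro less.IH) (auto simp: cball_def of_nat_diff)
    qed (use p0_pos in \<open>auto simp: m_def\<close>)
    finally have 1: "m * c1 \<le> hit {x} t v" using \<open>s \<le> t\<close> by simp
    have "real b powr - D1 = c1 * 4 powr D1 * real b powr - D1" using D1 by simp
    also have "\<dots> = c1 * (real b / 4) powr - D1"
      using b' by (simp add: powr_divide powr_minus field_simps)
    also have "\<dots> \<le> c1 * real b' powr - D1"
      using b' D1 c1_pos by (intro mult_left_mono powr_mono2') auto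
    finally have "p0 ^ 56 * real b powr - D1 \<le> p0 ^ 56 * (c1 * real b' powr - D1)"
      using p0_pos by (intro mult_left_mono) auto
    then show ?thesis using 1 by (simp add: m_def mult_ac)
  qed
qed

end

context p0_graph
begin

subsection \<open>The law of the walk\<close>

lemma measurable_coord: "(\<lambda>\<omega>. \<omega> i) \<in> measurable (path_law x) (count_space UNIV)"
  using measurable_component_singleton[of i UNIV "\<lambda>_. count_space UNIV"]
  by (simp add: measurable_cong_sets[OF sets_path_law refl])

lemma coord_in_sets: "{\<omega>. \<omega> i \<in> Y} \<in> sets (path_law x)"
  using measurable_sets[OF measurable_coord[of i x], of Y] by (simp add: vimage_def)

lemma prefix_sets: "{\<omega>. \<forall>i\<le>n. \<omega> i \<in> Y i} \<in> sets (path_law x)"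
  using sets.sets_Collect_finite_All[of "{..n}" "path_law x" "\<lambda>i \<omega>. \<omega> i \<in> Y i"] coord_in_sets
  by (auto simp: Ball_def)

abbreviation cyl :: "nat \<Rightarrow> (nat \<Rightarrow> 'a) \<Rightarrow> (nat \<Rightarrow> 'a) set" where
  "cyl n a \<equiv> {\<omega>. \<forall>i\<le>n. \<omega> i = a i}"

lemma cyl_sets: "cyl n a \<in> sets (path_law x)"
  using prefix_sets[of n "\<lambda>i. {a i}" x] by simp

lemma measure_cyl_Suc:
  "measure (path_law x) (cyl (Suc n) a) = measure (path_law x) (cyl n a) * trans_prob (a n) (a (Suc n))"
  unfolding measure_def path_law_Suc by (simp add: enn2real_mult trans_prob_nonneg)

lemma measure_start: "measure (path_law x) {\<omega>. \<omega> 0 = y} = indicator {x} y"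
proof -
  interpret prob_space "path_law x" by (rule prob_space_path_law)
  have 1: "measure (path_law x) {\<omega>. \<omega> 0 = x} = 1"
    using path_law_0[of x] by (simp add: measure_def)
  show ?thesis
  proof (cases "y = x")
    case False
    have "measure (path_law x) ({\<omega>. \<omega> 0 = x} \<union> {\<omega>. \<omega> 0 = y}) =
        measure (path_law x) {\<omega>. \<omega> 0 = x} + measure (path_law x) {\<omega>. \<omega> 0 = y}"
      using coord_in_sets[of 0 "{_}" x] False by (intro finite_measure_Union) auto
    then have "measure (path_law x) {\<omega>. \<omega> 0 = x} + measure (path_law x) {\<omega>. \<omega> 0 = y} \<le> 1"
      using prob_le_1 by metis
    then show ?thesis
      using 1 False measure_nonneg[of "path_law x" "{\<omega>. \<omega> 0 = y}"] by simp
  qed (use 1 in simp)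
qed

text \<open>Splitting off the last step of a path turns its transition probability into one
  application of \<open>kil A\<close>.\<close>

lemma sum_cyl:
  assumes "finite A" "\<And>y. y \<notin> A \<Longrightarrow> f y = 0"
  shows "(\<Sum>a\<in>PiE {..n} (\<lambda>_. A). measure (path_law x) (cyl n a) * f (a n)) = (kil A ^^ n) f x"
  using assms(2)
proof (induction n arbitrary: f)
  case 0
  have "(\<Sum>a\<in>PiE {..0} (\<lambda>_. A). measure (path_law x) (cyl 0 a) * f (a 0)) =
      (\<Sum>a\<in>PiE {0 :: nat} (\<lambda>_. A). indicator {x} (a 0) * f (a 0))"
    by (simp add: measure_start atMost_0)
  also have "\<dots> = (\<Sum>y\<in>A. indicator {x} y * f y)"
    by (rule sum.reindex_bij_witness[of _ "\<lambda>y. \<lambda>i\<in>{0}. y" "\<lambda>a. a 0"]) (auto simp: PiE_iff extensional_def)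
  also have "\<dots> = f x"
    using assms(1) 0 by (cases "x \<in> A") (auto simp: indicator_def if_distrib[of "\<lambda>t. t * _"] cong: if_cong)
  finally show ?case by simp
next
  case (Suc n)
  let ?I = "\<lambda>n. PiE {..n} (\<lambda>_. A)"
  have *: "measure (path_law x) (cyl n (a(Suc n := y))) = measure (path_law x) (cyl n a)" for a y
    by (intro arg_cong2[where f = measure] refl) auto
  have "(\<Sum>a\<in>?I (Suc n). measure (path_law x) (cyl (Suc n) a) * f (a (Suc n))) =
      (\<Sum>(a, y)\<in>?I n \<times> A. measure (path_law x) (cyl (Suc n) (a(Suc n := y))) * f y)"
    by (rule sum.reindex_bij_witness[of _ "\<lambda>(a, y). a(Suc n := y)" "\<lambda>a. (restrict a {..n}, a (Suc n))"])
      (auto simp: PiE_iff extensional_def fun_eq_iff restrict_def le_Suc_eq intro!: arg_cong2[where f = "(*)"] arg_cong2[where f = measure])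
  also have "\<dots> = (\<Sum>(a, y)\<in>?I n \<times> A. measure (path_law x) (cyl n a) * (trans_prob (a n) y * f y))"
    unfolding measure_cyl_Suc * by (intro sum.cong) auto
  also have "\<dots> = (\<Sum>a\<in>?I n. measure (path_law x) (cyl n a) * (\<Sum>y\<in>A. trans_prob (a n) y * f y))"
    by (simp add: sum.cartesian_product[symmetric] sum_distrib_left)
  also have "\<dots> = (\<Sum>a\<in>?I n. measure (path_law x) (cyl n a) * kil A f (a n))"
    using Suc.prems assms(1) by (intro sum.cong refl) (auto simp: kil_eq_sum PiE_iff)
  also have "\<dots> = (kil A ^^ n) (kil A f) x"
    by (rule Suc.IH) (simp add: kil_def)
  finally show ?case by (simp add: funpow_swap1)
qed

text \<open>Finiteness of \<open>A\<close> makes the event a finite disjoint union of cylinders.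
  \<open>Y = UNIV\<close> gives survival probabilities, a singleton gives transition
  probabilities.\<close>

lemma measure_stay:
  assumes "finite A"
  shows "measure (path_law x) {\<omega>. (\<forall>i\<le>n. \<omega> i \<in> A) \<and> \<omega> n \<in> Y} = (kil A ^^ n) (indicator (A \<inter> Y)) x"
proof -
  interpret prob_space "path_law x" by (rule prob_space_path_law)
  let ?I = "PiE {..n} (\<lambda>_. A)"
  let ?J = "{a \<in> ?I. a n \<in> Y}"
  have fin: "finite ?I" using assms by (intro finite_PiE) auto
  have "{\<omega>. (\<forall>i\<le>n. \<omega> i \<in> A) \<and> \<omega> n \<in> Y} = (\<Union>a\<in>?J. cyl n a)"
  proof (intro set_eqI iffI)
    fix \<omega> :: "nat \<Rightarrow> 'a"
    assume "\<omega> \<in> {\<omega>. (\<forall>i\<le>n. \<omega> i \<in> A) \<and> \<omega> n \<in> Y}"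
    then show "\<omega> \<in> (\<Union>a\<in>?J. cyl n a)"
      by (intro UN_I[of "restrict \<omega> {..n}"]) auto
  qed (auto simp: PiE_iff)
  moreover have "disjoint_family_on (cyl n) ?J"
    unfolding disjoint_family_on_def
  proof safe
    fix a b \<omega>
    assume "a \<in> ?I" "b \<in> ?I" "\<forall>i\<le>n. \<omega> i = a i" "\<forall>i\<le>n. \<omega> i = b i"
    then have "a = b" by (intro PiE_ext[of a _ _ b]) auto
    moreover assume "a \<noteq> b"
    ultimately show "\<omega> \<in> {}" by simp
  qed
  ultimately have "measure (path_law x) {\<omega>. (\<forall>i\<le>n. \<omega> i \<in> A) \<and> \<omega> n \<in> Y} =
      (\<Sum>a\<in>?J. measure (path_law x) (cyl n a))"
    using fin cyl_sets by (simp add: finite_measure_finite_Union image_subset_iff)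
  also have "\<dots> = (\<Sum>a\<in>?I. measure (path_law x) (cyl n a) * indicator (A \<inter> Y) (a n))"
  proof (rule sum.mono_neutral_cong_left[OF fin])
    have "a n \<in> A" if "a \<in> ?I" for a
      using that by (rule PiE_mem) simp
    then show "\<forall>a\<in>?I - ?J. measure (path_law x) (cyl n a) * indicator (A \<inter> Y) (a n) = 0"
      "\<And>a. a \<in> ?J \<Longrightarrow> measure (path_law x) (cyl n a) =
        measure (path_law x) (cyl n a) * indicator (A \<inter> Y) (a n)"
      by (simp_all add: indicator_def)
  qed blast
  also have "\<dots> = (kil A ^^ n) (indicator (A \<inter> Y)) x"
    using assms by (intro sum_cyl) auto
  finally show ?thesis .
qed

lemma less_exit_time_iff: "enat t < exit_time A \<omega> \<longleftrightarrow> (\<forall>i\<le>t. \<omega> i \<in> A)"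
proof -
  have "enat t < exit_time A \<omega> \<longleftrightarrow> enat (Suc t) \<le> exit_time A \<omega>"
    by (simp add: Suc_ile_eq)
  also have "\<dots> \<longleftrightarrow> (\<forall>s. \<omega> s \<notin> A \<longrightarrow> Suc t \<le> s)"
    by (simp add: exit_time_def le_INF_iff)
  also have "\<dots> \<longleftrightarrow> (\<forall>i\<le>t. \<omega> i \<in> A)"
    by (meson not_less_eq_eq)
  finally show ?thesis .
qed

text \<open>Tail-sum formula in \<open>[0,\<infinity>]\<close>, valid also where the exit time is
  infinite: a time is the number of \<open>t\<close> below it, and each tail event concerns finitely
  many coordinates.\<close>

lemma mean_exit_from_eq: "mean_exit_from y x R = ennreal (EE (gball x R) y)"
proof -
  let ?A = "gball x R"
  interpret prob_space "path_law y" by (rule prob_space_path_law)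
  have sets: "{\<omega>. \<forall>i\<le>t. \<omega> i \<in> ?A} \<in> sets (path_law y)" for t
    by (rule prefix_sets)
  have "ennreal_of_enat (exit_time ?A \<omega>) = (\<Sum>t. indicator {\<omega>. \<forall>i\<le>t. \<omega> i \<in> ?A} \<omega>)" for \<omega>
  proof -
    have "(\<lambda>i. if enat i < exit_time ?A \<omega> then 1 else 0) sums ennreal_of_enat (exit_time ?A \<omega>)"
      using sums_If_finite[of "\<lambda>r. enat r < exit_time ?A \<omega>" "\<lambda>_. 1 :: ennreal"]
      by (cases "exit_time ?A \<omega>") (simp_all add: sums_def of_nat_tendsto_top_ennreal)
    then show ?thesis
      by (simp add: sums_iff less_exit_time_iff indicator_def of_bool_def)
  qed
  then have "mean_exit_from y x R = (\<Sum>t. emeasure (path_law y) {\<omega>. \<forall>i\<le>t. \<omega> i \<in> ?A})"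
    unfolding mean_exit_from_def using sets by (simp add: nn_integral_suminf)
  also have "\<dots> = (\<Sum>t. ennreal (surv ?A t y))"
    using measure_stay[of ?A y _ UNIV] by (simp add: emeasure_eq_measure surv_def)
  also have "\<dots> = ennreal (EE ?A y)"
    unfolding EE_def by (intro suminf_ennreal2 surv_nonneg summable_surv) simp
  finally show ?thesis .
qed

lemma mean_exit_eq: "mean_exit x R = ennreal (EE (gball x R) x)"
  by (simp add: mean_exit_def mean_exit_from_eq)

text \<open>In \<open>pn n y x\<close> the walk starts at the last argument \<open>x\<close> and ends at \<open>y\<close>.\<close>

definition pn :: "nat \<Rightarrow> 'a \<Rightarrow> 'a \<Rightarrow> real" where
  "pn n y = (avg ^^ n) (indicator {y})"

lemma pn_0: "pn 0 y = indicator {y}"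
  by (simp add: pn_def)

lemma pn_Suc: "pn (Suc n) y x = avg (pn n y) x"
  by (simp add: pn_def)

lemma pn_nonneg: "pn n y x \<ge> 0"
  by (induction n arbitrary: x) (auto simp: pn_0 pn_Suc intro: avg_nonneg)

lemma kil_in: "x \<in> A \<Longrightarrow> kil A f x = avg f x" and kil_out: "x \<notin> A \<Longrightarrow> kil A f x = 0"
  by (simp_all add: kil_def)

lemma kil_power_le_pn: "(kil A ^^ n) (indicator {y}) x \<le> pn n y x"
proof (induction n arbitrary: x)
  case (Suc n)
  show ?case using avg_mono[of x "(kil A ^^ n) (indicator {y})" "pn n y"] Suc pn_nonneg[of "Suc n" y x]
    by (cases "x \<in> A") (auto simp: kil_in kil_out pn_Suc)
qed (simp add: pn_0)

text \<open>Finite propagation speed: within \<open>n\<close> steps the killing outside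
  \<open>A\<close> is not felt. This transfers results on finite sets to the whole graph.\<close>

lemma kil_power_eq_pn:
  assumes "gball x (real (Suc n)) \<subseteq> A"
  shows "(kil A ^^ n) (indicator {y}) x = pn n y x"
  using assms
proof (induction n arbitrary: x)
  case (Suc n)
  have "avg ((kil A ^^ n) (indicator {y})) x = avg (pn n y) x"
  proof (rule avg_cong)
    fix z assume z: "x \<sim> z"
    have "gball z (real (Suc n)) \<subseteq> gball x (real (Suc (Suc n)))"
    proof
      fix v assume "v \<in> gball z (real (Suc n))"
      then show "v \<in> gball x (real (Suc (Suc n)))"
        using gdist_triangle[of x v z] gdist_adj[OF z] by (simp add: gball_def)
    qed
    then show "(kil A ^^ n) (indicator {y}) z = pn n y z"
      using Suc by blast
  qed
  moreover have "x \<in> A" using Suc.prems self_in_gball[of "real (Suc (Suc n))" x] by auto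
  ultimately show ?case by (simp add: kil_in pn_Suc)
qed (simp add: pn_0)

lemma pn_sym: "vmeas x * pn n y x = vmeas y * pn n x y"
proof -
  let ?A = "gball x (real (Suc n)) \<union> gball y (real (Suc n))"
  have "vmeas x * (kil ?A ^^ n) (indicator {y}) x = vmeas y * (kil ?A ^^ n) (indicator {x}) y"
    by (rule kil_kernel_sym) (auto simp: self_in_gball)
  then show ?thesis by (simp add: kil_power_eq_pn)
qed

lemma heat_kernel_ge: "heat_kernel n x y \<ge> pn n x y / vmeas x"
proof -
  interpret prob_space "path_law x" by (rule prob_space_path_law)
  \<comment> \<open>Adjoining \<open>y\<close> makes \<open>?A \<inter> {y}\<close> equal to
    \<open>{y}\<close> even if \<open>y\<close> is too far away to be reached.\<close>
  let ?A = "gball x (real (Suc n)) \<union> {y}"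
  have "pn n y x = (kil ?A ^^ n) (indicator {y}) x"
    by (rule kil_power_eq_pn[symmetric]) auto
  also have "\<dots> = measure (path_law x) {\<omega>. (\<forall>i\<le>n. \<omega> i \<in> ?A) \<and> \<omega> n \<in> {y}}"
    using measure_stay[of ?A x n "{y}"] by (simp add: Int_absorb1 del: Un_insert_right)
  also have "\<dots> \<le> measure (path_law x) {\<omega>. \<omega> n = y}"
    using coord_in_sets[of n "{y}" x] by (intro finite_measure_mono) auto
  finally have "pn n y x / vmeas y \<le> heat_kernel n x y"
    using vmeas_pos[of y] by (simp add: heat_kernel_def divide_right_mono)
  moreover have "pn n y x / vmeas y = pn n x y / vmeas x"
    using pn_sym[of x n y] vmeas_pos[of x] vmeas_pos[of y] by (simp add: field_simps)
  ultimately show ?thesis by simp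
qed

text \<open>At the first visit to \<open>x\<close> some time \<open>j <= n\<close> is left, whence
  the minimum over all \<open>j\<close>. The sum over two consecutive times is compatible with the
  first-step recursion.\<close>

lemma pn_ge_hit:
  assumes "m \<ge> 0" "\<And>j. j \<le> n \<Longrightarrow> m \<le> pn j x x + pn (Suc j) x x"
  shows "m * hit {x} n v \<le> pn n x v + pn (Suc n) x v"
  using assms(2)
proof (induction n arbitrary: v)
  case 0
  then show ?case using pn_nonneg[of _ x v] by (cases "v = x") auto
next
  case (Suc n)
  show ?case
  proof (cases "v = x")
    case True
    then show ?thesis using Suc.prems[of "Suc n"] by simp
  next
    case False
    then have "m * hit {x} (Suc n) v = avg (\<lambda>y. m * hit {x} n y) v"
      by (simp add: avg_cmult)
    also have "\<dots> \<le> avg (\<lambda>y. pn n x y + pn (Suc n) x y) v"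
      using Suc by (intro avg_mono) auto
    finally show ?thesis by (simp only: avg_add pn_Suc[symmetric])
  qed
qed

text \<open>By self-adjointness the squared \<open>l^2\<close> norm of the killed kernel at time
  \<open>k\<close> is a return probability at time \<open>k + k\<close>, and its total mass is a
  survival probability. Cauchy-Schwarz compares the two.\<close>

lemma pn_diag_ge:
  assumes "finite B" "x \<in> B"
  shows "vmeas x * surv B k x ^ 2 \<le> (\<Sum>z\<in>B. vmeas z) * pn (k + k) x x"
proof -
  let ?f = "(kil B ^^ k) (indicator {x})"
  have out: "?f y = 0" if "y \<notin> B" for y
    using that assms(2) by (intro kil_power_outside) (auto simp: indicator_def)
  have delta: "(\<Sum>z\<in>B. vmeas z * (indicator {x} z * g z)) = vmeas x * g x" for g
  proof -
    have "(\<Sum>z\<in>B. vmeas z * (indicator {x} z * g z)) = (\<Sum>z\<in>B. if z = x then vmeas z * g z else 0)"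
      by (intro sum.cong) auto
    then show ?thesis using assms by simp
  qed
  have "(\<Sum>z\<in>B. vmeas z * (?f z * ?f z)) = (\<Sum>z\<in>B. vmeas z * (indicator {x} z * (kil B ^^ k) ?f z))"
    using assms out by (intro kil_power_self_adjoint) (auto simp: indicator_def)
  also have "\<dots> = vmeas x * (kil B ^^ (k + k)) (indicator {x}) x"
    unfolding delta by (simp add: funpow_add)
  also have "\<dots> \<le> vmeas x * pn (k + k) x x"
    using vmeas_pos[of x] by (intro mult_left_mono kil_power_le_pn) auto
  finally have 1: "(\<Sum>z\<in>B. vmeas z * (?f z * ?f z)) \<le> vmeas x * pn (k + k) x x" .
  have "(\<Sum>z\<in>B. vmeas z * ?f z) = (\<Sum>z\<in>B. vmeas z * (?f z * indicator B z))"
    by (intro sum.cong) auto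
  also have "\<dots> = (\<Sum>z\<in>B. vmeas z * (indicator {x} z * (kil B ^^ k) (indicator B) z))"
    using assms by (intro kil_power_self_adjoint) (auto simp: indicator_def)
  also have "\<dots> = vmeas x * surv B k x"
    unfolding delta surv_def ..
  finally have 2: "(\<Sum>z\<in>B. vmeas z * ?f z) = vmeas x * surv B k x" .
  have "(\<Sum>z\<in>B. sqrt (vmeas z) * (sqrt (vmeas z) * ?f z))\<^sup>2 \<le>
      (\<Sum>z\<in>B. (sqrt (vmeas z))\<^sup>2) * (\<Sum>z\<in>B. (sqrt (vmeas z) * ?f z)\<^sup>2)"
    by (rule Cauchy_Schwarz_ineq_sum)
  moreover have "sqrt (vmeas z) * (sqrt (vmeas z) * ?f z) = vmeas z * ?f z"
    "(sqrt (vmeas z))\<^sup>2 = vmeas z" "(sqrt (vmeas z) * ?f z)\<^sup>2 = vmeas z * (?f z * ?f z)" for z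
    using vmeas_pos[of z] by (simp flip: mult.assoc, simp, simp add: power_mult_distrib power2_eq_square)
  ultimately have "(vmeas x * surv B k x)\<^sup>2 \<le> (\<Sum>z\<in>B. vmeas z) * (\<Sum>z\<in>B. vmeas z * (?f z * ?f z))"
    using 2 by simp
  also have "\<dots> \<le> (\<Sum>z\<in>B. vmeas z) * (vmeas x * pn (k + k) x x)"
    using 1 vmeas_pos by (intro mult_left_mono sum_nonneg) (auto intro: less_imp_le)
  finally have "vmeas x * (vmeas x * surv B k x ^ 2) \<le> vmeas x * ((\<Sum>z\<in>B. vmeas z) * pn (k + k) x x)"
    by (simp add: power2_eq_square mult_ac)
  then show ?thesis
    using vmeas_pos[of x] by (subst (asm) mult_le_cancel_left_pos) auto
qed

section \<open>Volume, inverse mean exit time and chaining number as real quantities\<close>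

lemma vol_eq: "vol x R = (\<Sum>z\<in>gball x R. vmeas z)"
  by (simp add: vol_def)

lemma vmeas_le_vol: "R > 0 \<Longrightarrow> vmeas x \<le> vol x R"
  unfolding vol_eq using vmeas_pos by (intro member_le_sum) (auto simp: self_in_gball intro: less_imp_le)

lemma inv_mean_exit: "inv_mean_exit x n \<ge> 1" "EE (gball x (real (inv_mean_exit x n))) x \<ge> real n"
proof -
  have "\<exists>r. r \<ge> 1 \<and> mean_exit x (real r) \<ge> of_nat n"
  proof (intro exI conjI)
    have "real n \<le> EE (gball x (real (Suc n))) x"
      using EE_ball_ge[of "Suc n" x] by simp
    then show "of_nat n \<le> mean_exit x (real (Suc n))"
      unfolding mean_exit_eq by (metis ennreal_leI ennreal_of_nat_eq_real_of_nat)
  qed simp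
  then have *: "inv_mean_exit x n \<ge> 1 \<and> mean_exit x (real (inv_mean_exit x n)) \<ge> of_nat n"
    unfolding inv_mean_exit_def by (rule LeastI_ex)
  then show "inv_mean_exit x n \<ge> 1" by blast
  from * show "EE (gball x (real (inv_mean_exit x n))) x \<ge> real n"
    unfolding mean_exit_eq ennreal_of_nat_eq_real_of_nat by (subst (asm) ennreal_le_iff) (auto simp: EE_nonneg)
qed

lemma l9_admissible_bound:
  assumes "l9_admissible Q x y s R l" "z \<in> geod x y" "Q \<ge> 0" "s \<ge> 0"
  shows "Q * EE (gball z (9 * R / real l)) z \<le> s / real l"
proof -
  have "mean_exit z (9 * R / real l) \<le> Max ((\<lambda>z. mean_exit z (9 * R / real l)) ` geod x y)"
    using assms(2) finite_geod[OF cond_p0] by (intro Max_ge) auto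
  then have "ennreal Q * mean_exit z (9 * R / real l) \<le> ennreal (s / real l)"
    using assms(1) mult_left_mono[of _ _ "ennreal Q"] unfolding l9_admissible_def
    by (meson order_trans zero_le)
  then show ?thesis
    using assms by (simp add: mean_exit_eq ennreal_mult'[symmetric] ennreal_le_iff)
qed

end

context harnack_graph
begin

subsection \<open>The lower bound\<close>

text \<open>By time \<open>N\<close> at most \<open>N\<close> has elapsed, and a walk still inside
  then expects at most \<open>M\<close> more. Read backwards, a large mean exit time forces a large
  survival probability.\<close>

lemma EE_le_surv:
  assumes "\<And>y. y \<in> B \<Longrightarrow> EE B y \<le> M" "finite B" "M \<ge> 0"
  shows "EE B x \<le> real N + M * surv B N x"
proof -
  have "EE B x \<le> (\<Sum>k<N. surv B k x) + M * surv B N x"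
  proof (induction N arbitrary: x)
    case 0
    show ?case using assms(1)[of x] by (cases "x \<in> B") (auto simp: EE_outside)
  next
    case (Suc N)
    show ?case
    proof (cases "x \<in> B")
      case True
      have "EE B x = 1 + avg (EE B) x" by (rule EE_eq[OF assms(2) True])
      also have "\<dots> \<le> 1 + avg (\<lambda>y. (\<Sum>k<N. surv B k y) + M * surv B N y) x"
        by (intro add_left_mono avg_mono Suc.IH)
      also have "\<dots> = (\<Sum>k<Suc N. surv B k x) + M * surv B (Suc N) x"
        using True by (simp only: sum.lessThan_Suc_shift surv_Suc surv_0 avg_sum avg_add avg_cmult) simp
      finally show ?thesis by simp
    next
      case False
      then show ?thesis by (simp add: EE_outside surv_outside)
    qed
  qed
  also have "(\<Sum>k<N. surv B k x) \<le> real N"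
    using sum_bounded_above[of "{..<N}" "\<lambda>k. surv B k x" 1] surv_le_1 by simp
  finally show ?thesis by simp
qed

lemma diagonal_bound:
  assumes n: "n \<ge> 1" and j: "j \<le> n"
  shows "p0 / (16 * CE\<^sup>2) * vmeas x / vol x (real (inv_mean_exit x n)) \<le> pn j x x + pn (Suc j) x x"
proof -
  define R where "R = inv_mean_exit x n"
  let ?B = "gball x (real R)"
  have R: "R \<ge> 1" and E: "Ez x R \<ge> real n"
    unfolding R_def by (rule inv_mean_exit)+
  have V: "vmeas x \<le> vol x (real R)" using R by (intro vmeas_le_vol) simp
  have Vpos: "vol x (real R) > 0" using V vmeas_pos[of x] by linarith
  have CE2: "CE\<^sup>2 \<ge> 1" using CE_ge_1 by simp
  have "p0 / (16 * CE\<^sup>2) * vmeas x \<le> (pn j x x + pn (Suc j) x x) * vol x (real R)"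
  proof (cases "n = 1")
    \<comment> \<open>For \<open>j = 1\<close> the \<open>k\<close> of the other case would equal
      \<open>n\<close>, violating \<open>k <= 3 / 4 * n\<close>. A step to a neighbour and back
      supplies \<open>p0\<close> instead.\<close>
    case True
    have "pn 1 x z \<ge> p0" if "x \<sim> z" for z
      using avg_ge[OF adj_sym[OF that], of "indicator {x}"] by (simp add: pn_Suc pn_0)
    then have "p0 \<le> pn 2 x x"
      using avg_mono[of x "\<lambda>_. p0" "pn 1 x"] pn_Suc[of 1 x x] by (simp add: numeral_2_eq_2)
    moreover have "pn 0 x x = 1" by (simp add: pn_0)
    moreover have "j = 0 \<or> j = 1" using True j by auto
    ultimately have "p0 \<le> pn j x x + pn (Suc j) x x"
      using pn_nonneg[of j x x] pn_nonneg[of "Suc j" x x] p0_le_1 by (auto simp: numeral_2_eq_2)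
    moreover have "p0 / (16 * CE\<^sup>2) \<le> p0 / 1"
      by (rule divide_left_mono) (use CE2 p0_pos in linarith)+
    ultimately have "p0 / (16 * CE\<^sup>2) \<le> pn j x x + pn (Suc j) x x" by simp
    then show ?thesis
      using V vmeas_pos[of x] pn_nonneg[of j x x] pn_nonneg[of "Suc j" x x] by (intro mult_mono) auto
  next
    case False
    \<comment> \<open>\<open>k + k\<close> is the even one of \<open>j\<close> and
      \<open>Suc j\<close>. For \<open>n >= 2\<close> this leaves at least a quarter of the mean
      exit time beyond \<open>k\<close>, whence the 4 in \<open>1 / (4 * CE)\<close>.\<close>
    define k where "k = (j + 1) div 2"
    have "4 * k \<le> 3 * n" using n j False unfolding k_def by linarith
    then have k: "real k \<le> 3 / 4 * real n" by linarith
    have kk: "k + k = j \<or> k + k = Suc j" unfolding k_def by presburger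
    have "Ez x R \<le> real k + CE * Ez x R * surv ?B k x"
      using CE_ge_1 EE_nonneg[of ?B x] R by (intro EE_le_surv E_bar) auto
    then have "Ez x R * (1 / 4) \<le> Ez x R * (CE * surv ?B k x)"
      using k E by (simp add: algebra_simps)
    moreover have "Ez x R > 0" using E n by linarith
    ultimately have "1 / 4 \<le> CE * surv ?B k x"
      by (simp only: mult_le_cancel_left_pos)
    then have "1 / (4 * CE) \<le> surv ?B k x"
      using CE_ge_1 by (simp add: field_simps)
    then have "(1 / (4 * CE))\<^sup>2 \<le> (surv ?B k x)\<^sup>2"
      using CE_ge_1 by (intro power_mono) auto
    then have "1 / (16 * CE\<^sup>2) \<le> (surv ?B k x)\<^sup>2"
      by (simp add: power_divide power_mult_distrib)
    moreover have "p0 / (16 * CE\<^sup>2) \<le> 1 / (16 * CE\<^sup>2)"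
      using p0_le_1 CE2 by (intro divide_right_mono) auto
    ultimately have "p0 / (16 * CE\<^sup>2) \<le> (surv ?B k x)\<^sup>2" by linarith
    then have "p0 / (16 * CE\<^sup>2) * vmeas x \<le> (surv ?B k x)\<^sup>2 * vmeas x"
      using vmeas_pos[of x] by (intro mult_right_mono) auto
    also have "\<dots> = vmeas x * (surv ?B k x)\<^sup>2" by (rule mult.commute)
    also have "\<dots> \<le> vol x (real R) * pn (k + k) x x"
      unfolding vol_eq using R by (intro pn_diag_ge) (auto simp: self_in_gball)
    also have "\<dots> \<le> vol x (real R) * (pn j x x + pn (Suc j) x x)"
      using kk pn_nonneg[of j x x] pn_nonneg[of "Suc j" x x] Vpos by (intro mult_left_mono) auto
    also have "\<dots> = (pn j x x + pn (Suc j) x x) * vol x (real R)" by (rule mult.commute)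
    finally show ?thesis .
  qed
  then show ?thesis
    unfolding R_def[symmetric] pos_divide_le_eq[OF Vpos] .
qed

text \<open>In \<open>Q2\<close>, \<open>q1 + 1\<close> pays for one step of the chain including the
  rounding of its duration, and \<open>K1\<close> for the approach to \<open>x\<close>. In
  \<open>C2\<close>, \<open>ln (1 / c1)\<close> is the cost of one ball of the chain; the other
  summands serve the case of large \<open>l\<close>.\<close>

definition Q2 :: real where "Q2 = 1 + q1 + K1"
definition C2 :: real where "C2 = 48 * ln (1 / p0) + 3 * D1 + ln (1 / c1)"

lemma K1_pos: "K1 > 0"
  using CE_ge_1 q1_ge_1 by (simp add: K1_def add_pos_nonneg)

lemma Q2_pos: "Q2 > 0"
  using K1_pos q1_ge_1 by (simp add: Q2_def)

lemma C2_parts: "ln (1 / p0) \<ge> 0" "ln (1 / c1) \<ge> 0"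
  using p0_pos p0_le_1 c1_pos c1_le_1 by (auto intro!: ln_ge_zero simp: le_divide_eq)

lemma C2_pos: "C2 > 0"
  using C2_parts D1(1) by (simp add: C2_def)

section \<open>Chaining along a geodesic\<close>

lemma div_step: "(a + d) div l - a div l \<le> d div l + 1" for a d l :: nat
proof (cases "l = 0")
  case False
  have "(a mod l + d mod l) div l < 2"
    using False by (intro less_mult_imp_div_less) (simp add: add_strict_mono mult_2)
  then have "(a mod l + d mod l) div l \<le> 1" by simp
  then show ?thesis using div_add1_eq[of a d l] by linarith
qed simp

lemma hit_via_chain:
  assumes L: "l9_admissible Q2 x y (real n / 2) (real (gdist x y)) L"
    and far: "48 * L \<le> gdist x y"
  shows "hit {x} n y \<ge> p0 ^ 56 * (real (gdist x y) / (3 * real L)) powr - D1 * c1 ^ L"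
proof -
  let ?d = "gdist x y"
  \<comment> \<open>The 24 meets three demands: \<open>48 * L <= d\<close> gives
    \<open>b >= 2\<close>, \<open>80 * b\<close> stays below the radius \<open>9 * d / L\<close> of
    admissibility, and the spacing of the centres, about \<open>d / L\<close>, stays below
    \<open>52 * b\<close>.\<close>
  define b where "b = ?d div (24 * L)"
  have L1: "L \<ge> 1" using L by (simp add: l9_admissible_def)
  have b: "b \<ge> 2" unfolding b_def using far L1 by (simp add: less_eq_div_iff_mult_less_eq)
  have bd: "24 * L * b \<le> ?d" unfolding b_def by (rule times_div_less_eq_dividend)
  have "?d < 24 * L * (b + 1)"
    unfolding b_def using L1 dividend_less_times_div[of "24 * L" ?d] by (simp add: add.commute)
  then have "?d div L < 24 * (b + 1)"
    using L1 by (intro less_mult_imp_div_less) (simp add: mult_ac)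
  then have step: "?d div L + 1 \<le> 52 * b" using b by simp
  obtain \<gamma> where \<gamma>: "\<gamma> 0 = x" "\<gamma> ?d = y" "\<And>i. i \<le> ?d \<Longrightarrow> \<gamma> i \<in> geod x y"
    "\<And>i j. i \<le> j \<Longrightarrow> j \<le> ?d \<Longrightarrow> gdist (\<gamma> i) (\<gamma> j) = j - i"
    by (rule geodesic[of x y]) blast
  \<comment> \<open>The index runs backwards since the walk starts at \<open>y\<close> and the
    geodesic at \<open>x\<close>. Rounding down adds at most 1 to the spacing, by
    \<open>div_step\<close>.\<close>
  define z where "z i = \<gamma> ((L - i) * ?d div L)" for i
  have idx: "(L - i) * ?d div L \<le> ?d" for i
  proof -
    have "(L - i) * ?d div L \<le> L * ?d div L" by (intro div_le_mono mult_le_mono1) simp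
    then show ?thesis using L1 by simp
  qed
  have E: "Q2 * Ez (z i) (80 * b) \<le> real n / 2 / real L" for i
  proof -
    have "real (24 * L * b) \<le> real ?d" using bd by (simp only: of_nat_le_iff)
    then have "real (80 * b) \<le> 9 * real ?d / real L"
      using L1 by (simp add: field_simps)
    then have "Ez (z i) (80 * b) \<le> EE (gball (z i) (9 * real ?d / real L)) (z i)"
      by (intro EE_mono gball_mono) auto
    then have "Q2 * Ez (z i) (80 * b) \<le> Q2 * EE (gball (z i) (9 * real ?d / real L)) (z i)"
      using Q2_pos by simp
    also have "\<dots> \<le> real n / 2 / real L"
      using Q2_pos by (intro l9_admissible_bound[OF L]) (auto simp: z_def intro: \<gamma>(3) idx)
    finally show ?thesis .
  qed
  have E1: "Ez (z i) (80 * b) \<ge> 1" for i using b by (intro Ez_ge_1) simp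
  \<comment> \<open>The chain takes \<open>L * T <= n / 2\<close>, leaving at least
    \<open>n / 2\<close> for \<open>hit_centre\<close>. The rounding loss, less than 1, is covered
    by the 1 in \<open>Q2\<close>.\<close>
  define T where "T = n div (2 * L)"
  have "n < 2 * L * (T + 1)"
    unfolding T_def using L1 dividend_less_times_div[of "2 * L" n] by (simp add: add.commute)
  then have "real n < real (2 * L * (T + 1))" by (simp only: of_nat_less_iff)
  then have T: "real n / 2 / real L \<le> real T + 1"
    using L1 by (simp add: field_simps)
  have LT: "2 * (L * T) \<le> n"
    unfolding T_def using times_div_less_eq_dividend[of "2 * L" n] by (simp add: mult.assoc)
  define t where "t = n - L * T"
  have t: "real t \<ge> real n / 2" "L * T + t = n"
  proof -
    have "real (2 * (L * T)) \<le> real n" using LT by (simp only: of_nat_le_iff)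
    then show "real t \<ge> real n / 2" using LT by (simp add: t_def of_nat_diff)
    show "L * T + t = n" using LT by (simp add: t_def)
  qed
  have q1T: "q1 * Ez (z i) (80 * b) \<le> real T" for i
  proof -
    have "(q1 + 1) * Ez (z i) (80 * b) \<le> Q2 * Ez (z i) (80 * b)"
      using E1[of i] K1_pos by (intro mult_right_mono) (auto simp: Q2_def)
    then show ?thesis using E[of i] T E1[of i] by (simp add: algebra_simps)
  qed
  have z0: "z 0 = y" and zL: "z L = x"
    using L1 \<gamma>(1,2) by (auto simp: z_def)
  have K1t: "K1 * Ez x (80 * b) \<le> real t"
  proof -
    have "K1 * Ez x (80 * b) \<le> Q2 * Ez x (80 * b)"
      using E1[of L] zL q1_ge_1 by (intro mult_right_mono) (auto simp: Q2_def)
    also have "\<dots> \<le> real n / 2 / real L" using E[of L] zL by simp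
    also have "\<dots> \<le> real n / 2" using L1 by (simp add: divide_le_eq mult_le_cancel_left1)
    finally show ?thesis using t(1) by linarith
  qed
  have "c1 ^ L * (p0 ^ 56 * real b powr - D1) \<le> hit {x} (L * T + t) y"
  proof (rule hit_along_chain[OF b, where z = z])
    fix i assume i: "i < L"
    let ?a = "(L - Suc i) * ?d"
    have Si: "(L - i) * ?d = ?a + ?d"
      using i by (simp flip: Suc_diff_Suc)
    have "gdist (z (Suc i)) (z i) = (?a + ?d) div L - ?a div L"
      unfolding z_def Si using idx[of i] by (intro \<gamma>(4)) (auto simp: Si div_le_mono)
    then show "gdist (z i) (z (Suc i)) \<le> 52 * b"
      using div_step[of ?a ?d L] step gdist_sym[of "z i"] by simp
  next
    fix v assume "gdist (z L) v \<le> 8 * b"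
    then show "p0 ^ 56 * real b powr - D1 \<le> hit {x} t v"
      using b zL K1t by (intro hit_centre) auto
  qed (use q1T z0 p0_pos in auto)
  moreover have "(real ?d / (3 * real L)) powr - D1 \<le> real b powr - D1"
  proof (rule powr_mono2')
    have "b * (3 * L) \<le> 24 * L * b" by simp
    then have "real (b * (3 * L)) \<le> real ?d" using bd by (simp only: of_nat_le_iff)
    then have "real b * (3 * real L) \<le> real ?d" by simp
    then show "real b \<le> real ?d / (3 * real L)"
      using L1 by (simp add: pos_le_divide_eq)
  qed (use b D1(1) in auto)
  then have "p0 ^ 56 * (real ?d / (3 * real L)) powr - D1 * c1 ^ L \<le> c1 ^ L * (p0 ^ 56 * real b powr - D1)"
    using p0_pos c1_pos mult_left_mono[of "(real ?d / (3 * real L)) powr - D1" "real b powr - D1" "c1 ^ L * p0 ^ 56"]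
    by (simp add: mult_ac)
  ultimately show ?thesis using t(2) by simp
qed

lemma l9_cases:
  assumes "x \<noteq> y"
  obtains L where "l9_admissible Q x y s (real (gdist x y)) L" "l9 Q x y s (real (gdist x y)) = real L" "L \<ge> 1"
  | "l9 Q x y s (real (gdist x y)) = real (gdist x y)"
proof (cases "\<exists>l. l9_admissible Q x y s (real (gdist x y)) l")
  case True
  then have "l9_admissible Q x y s (real (gdist x y)) (LEAST l. l9_admissible Q x y s (real (gdist x y)) l)"
    by (rule LeastI_ex)
  moreover from this have "(LEAST l. l9_admissible Q x y s (real (gdist x y)) l) \<ge> 1"
    unfolding l9_admissible_def by (rule conjunct1)
  ultimately show ?thesis
    using True by (intro that(1)) (simp_all only: l9_def if_True)
next
  case False
  then show ?thesis using that(2) unfolding l9_def by presburger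
qed

text \<open>
  If \<open>l > d / 48\<close>, following a geodesic already has probability at least \<open>exp (- 48 ln (1 / p0) l)\<close>;
  the factor \<open>r powr - D1\<close>, which is large for small \<open>r = d / (3 l)\<close>, is absorbed by \<open>exp (- 3 D1 l)\<close>.
\<close>

lemma hit_lower_bound:
  assumes "x \<noteq> y" "gdist x y \<le> n"
  defines "l \<equiv> l9 Q2 x y (real n / 2) (real (gdist x y))"
  defines "r \<equiv> real (gdist x y) / (3 * l)"
  shows "p0 ^ 56 * r powr - D1 * exp (- C2 * l) \<le> hit {x} n y" "r > 0"
proof -
  let ?d = "gdist x y"
  have d: "?d \<ge> 1" using assms(1) gdist_eq_0_iff[of x y] by linarith
  have l: "l > 0"
    by (rule l9_cases[OF assms(1), of Q2 "real n / 2"]) (use d in \<open>auto simp: l_def\<close>)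
  then show "r > 0" using d by (simp add: r_def)
  show "p0 ^ 56 * r powr - D1 * exp (- C2 * l) \<le> hit {x} n y"
  proof (cases "real ?d < 48 * l")
    case True
    have "r powr - D1 = (3 * l / real ?d) powr D1"
      using l d by (simp add: r_def powr_minus powr_divide field_simps)
    also have "\<dots> \<le> (3 * l) powr D1"
    proof (rule powr_mono2)
      show "3 * l / real ?d \<le> 3 * l" using l d by (simp add: divide_le_eq mult_le_cancel_left1)
    qed (use l d D1(1) in auto)
    also have "\<dots> \<le> exp (3 * l) powr D1"
      using l D1(1) exp_ge_add_one_self[of "3 * l"] by (intro powr_mono2) linarith+
    also have "\<dots> = exp (3 * D1 * l)" by (simp add: powr_def mult_ac)
    finally have r: "r powr - D1 \<le> exp (3 * D1 * l)" .
    have "p0 ^ 56 * r powr - D1 * exp (- C2 * l) \<le> 1 * exp (3 * D1 * l) * exp (- C2 * l)"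
      using r p0_pos p0_le_1 by (intro mult_mono) (auto intro: power_le_one)
    also have "\<dots> = exp (- (48 * l) * ln (1 / p0) - ln (1 / c1) * l)"
      by (simp only: mult_1 exp_add[symmetric]) (simp add: C2_def algebra_simps)
    also have "\<dots> \<le> exp (- real ?d * ln (1 / p0))"
      using mult_right_mono[OF less_imp_le[OF True] C2_parts(1)]
        mult_nonneg_nonneg[OF C2_parts(2) less_imp_le[OF l]]
      by simp
    also have "\<dots> = p0 ^ ?d"
      using p0_pos by (simp add: ln_div exp_of_nat_mult)
    also have "\<dots> \<le> hit {x} n y"
      using hit_point_ge[of y x n] assms(2) gdist_sym[of x y] by simp
    finally show ?thesis .
  next
    case False
    show ?thesis
    proof (rule l9_cases[OF assms(1), of Q2 "real n / 2"])
      fix L assume L: "l9_admissible Q2 x y (real n / 2) (real ?d) L" "l9 Q2 x y (real n / 2) (real ?d) = real L"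
        and "L \<ge> 1"
      have "48 * L \<le> ?d" using False L(2) by (simp add: l_def)
      then have "p0 ^ 56 * r powr - D1 * c1 ^ L \<le> hit {x} n y"
        using hit_via_chain[OF L(1)] L(2) by (simp add: r_def l_def)
      moreover have "exp (- C2 * l) \<le> c1 ^ L"
      proof -
        have "ln (1 / c1) \<le> C2" using C2_parts D1(1) by (simp add: C2_def)
        then have "real L * ln (1 / c1) \<le> real L * C2" by (rule mult_left_mono) simp
        then have "exp (- C2 * l) \<le> exp (- real L * ln (1 / c1))"
          using L(2) by (simp add: l_def mult.commute)
        also have "\<dots> = c1 ^ L" using c1_pos by (simp add: ln_div exp_of_nat_mult)
        finally show ?thesis .
      qed
      then have "p0 ^ 56 * r powr - D1 * exp (- C2 * l) \<le> p0 ^ 56 * r powr - D1 * c1 ^ L"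
        using p0_pos by (intro mult_left_mono) auto
      ultimately show ?thesis by linarith
    next
      \<comment> \<open>The default value \<open>l = d\<close> contradicts
        \<open>48 * l <= d\<close>, so it falls under the geodesic case.\<close>
      assume "l9 Q2 x y (real n / 2) (real ?d) = real ?d"
      then show ?thesis using False d by (simp add: l_def)
    qed
  qed
qed

theorem heat_kernel_lower_bound:
  assumes "x \<noteq> y" "gdist x y \<le> n"
  defines "l \<equiv> l9 Q2 x y (real n / 2) (real (gdist x y))"
  defines "r \<equiv> real (gdist x y) / (3 * l)"
  shows "p0 ^ 57 / (16 * CE\<^sup>2) / (vol x (real (inv_mean_exit x n)) * r powr D1) * exp (- C2 * l)
    \<le> heat_kernel2 n x y"
proof -
  let ?V = "vol x (real (inv_mean_exit x n))"
  define m where "m = p0 / (16 * CE\<^sup>2) * vmeas x / ?V"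
  have hit: "p0 ^ 56 * r powr - D1 * exp (- C2 * l) \<le> hit {x} n y" and r: "r > 0"
    using hit_lower_bound[OF assms(1,2)] by (simp_all add: l_def r_def)
  have "gdist x y \<noteq> 0" using assms(1) by simp
  then have n: "n \<ge> 1" using assms(2) by linarith
  have V: "?V > 0"
    using vmeas_pos[of x] vmeas_le_vol[of "real (inv_mean_exit x n)" x] inv_mean_exit(1)[where x = x and n = n] by simp
  have m: "m \<ge> 0" unfolding m_def using V p0_pos vmeas_pos[of x] by simp
  have "p0 ^ 57 / (16 * CE\<^sup>2) / (?V * r powr D1) * exp (- C2 * l)
      = m * (p0 ^ 56 * r powr - D1 * exp (- C2 * l)) / vmeas x"
  proof -
    \<comment> \<open>56 factors come from hitting \<open>x\<close>, one from the diagonal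
      bound.\<close>
    have "p0 ^ 57 = p0 * p0 ^ 56" by (simp flip: power_Suc)
    then show ?thesis using vmeas_pos[of x] by (simp add: m_def powr_minus_divide)
  qed
  also have "\<dots> \<le> m * hit {x} n y / vmeas x"
    using hit m vmeas_pos[of x] by (intro divide_right_mono mult_left_mono) auto
  also have "\<dots> \<le> (pn n x y + pn (Suc n) x y) / vmeas x"
    using m n vmeas_pos[of x] unfolding m_def
    by (intro divide_right_mono pn_ge_hit diagonal_bound) auto
  also have "\<dots> \<le> heat_kernel2 n x y"
    using heat_kernel_ge[where x = x and y = y and n = n] heat_kernel_ge[where x = x and y = y and n = "Suc n"]
    by (simp add: heat_kernel2_def add_divide_distrib)
  finally show ?thesis .
qed

end

section \<open>Passage from the stated conditions to the pointwise ones\<close>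

theorem theorem36:
  fixes adj :: "'a \<Rightarrow> 'a \<Rightarrow> bool" and w :: "'a \<Rightarrow> 'a \<Rightarrow> real"
  assumes "weighted_graph adj w"
    and "weighted_graph.cond_p0 adj w"
    and "weighted_graph.cond_E_bar adj w"
    and "weighted_graph.elliptic_harnack adj w"
  shows "\<exists>Q c C D :: real. Q > 0 \<and> c > 0 \<and> C > 0 \<and> D > 0 \<and>
    (\<forall>x y n. x \<noteq> y \<longrightarrow> n \<ge> weighted_graph.gdist adj x y \<longrightarrow>
      (let d = real (weighted_graph.gdist adj x y);
           l = weighted_graph.l9 adj w Q x y (real n / 2) d;
           r = d / (3 * l)
       in weighted_graph.heat_kernel2 adj w n x y \<ge>
            c / (weighted_graph.vol adj w x (real (weighted_graph.inv_mean_exit adj w x n))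
                 * r powr D) * exp (- C * l)))"
proof -
  interpret weighted_graph adj w by fact
  obtain p0 where p0: "p0 > 0" "\<And>x y. adj x y \<Longrightarrow> p0 \<le> trans_prob x y"
    using assms(2) unfolding cond_p0_def by blast
  interpret p0_graph adj w p0 by unfold_locales (fact p0)+
  obtain CE where CE: "CE > 0"
    "\<And>x R. R > 0 \<Longrightarrow> max_mean_exit x R \<le> ennreal CE * mean_exit x R"
    using assms(3) unfolding cond_E_bar_def by blast
  obtain CH where CH: "CH > 0"
    "\<And>x R u. R > 0 \<Longrightarrow> (\<forall>z \<in> gball x (2 * R) \<union> gboundary (gball x (2 * R)). u z \<ge> 0) \<Longrightarrow>
      harmonic_on u (gball x (2 * R)) \<Longrightarrow> Max (u ` gball x R) \<le> CH * Min (u ` gball x R)"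
    using assms(4) unfolding elliptic_harnack_def by blast
  \<comment> \<open>The given constants are only positive; enlarging them to at least 1 keeps both
    inequalities, because \<open>EE\<close> and \<open>u\<close> are non-negative.\<close>
  interpret harnack_graph adj w p0 "max 1 CE" "max 1 CH"
  proof
    fix R :: real and x y assume R: "R > 0" and y: "y \<in> gball x R"
    have "mean_exit_from y x R \<le> max_mean_exit x R"
      unfolding max_mean_exit_def using y by (intro Max_ge) auto
    then have "mean_exit_from y x R \<le> ennreal CE * mean_exit x R"
      using CE(2)[OF R] order_trans by blast
    then have "EE (gball x R) y \<le> CE * EE (gball x R) x"
      using CE(1) EE_nonneg[of "gball x R" x]
      by (simp add: mean_exit_from_eq mean_exit_eq ennreal_mult'[symmetric] ennreal_le_iff)
    also have "\<dots> \<le> max 1 CE * EE (gball x R) x"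
      by (intro mult_right_mono EE_nonneg) auto
    finally show "EE (gball x R) y \<le> max 1 CE * EE (gball x R) x" .
  next
    fix R :: real and u :: "'a \<Rightarrow> real" and x a b
    assume R: "R > 0" and u: "\<And>z. u z \<ge> 0" "\<And>y. y \<in> gball x (2 * R) \<Longrightarrow> avg u y = u y"
      and a: "a \<in> gball x R" and b: "b \<in> gball x R"
    have "u a \<le> Max (u ` gball x R)" using a by (intro Max_ge) auto
    also have "\<dots> \<le> CH * Min (u ` gball x R)"
      using u by (intro CH(2) R) (auto simp: harmonic_on_iff)
    also have "\<dots> \<le> CH * u b" using b CH(1) by (intro mult_left_mono Min_le) auto
    also have "\<dots> \<le> max 1 CH * u b" by (intro mult_right_mono u(1)) auto
    finally show "u a \<le> max 1 CH * u b" .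
  qed auto
  show ?thesis
  proof (rule exI[of _ Q2], rule exI[of _ "p0 ^ 57 / (16 * (max 1 CE)\<^sup>2)"], rule exI[of _ C2],
      rule exI[of _ D1], intro conjI)
    show "Q2 > 0" "C2 > 0" "D1 > 0" by (rule Q2_pos C2_pos D1(1))+
    show "p0 ^ 57 / (16 * (max 1 CE)\<^sup>2) > 0" using p0(1) by (simp add: zero_less_power)
  qed (unfold Let_def, intro allI impI, rule heat_kernel_lower_bound)
qed

end
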